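(* For all integers $n\ge1$ and $m\ge n+1$, there exists a minimum proper holomorphic map from $\mathbb{B}^n$ to $D^{IV}_m$.
   Context: $\mathbb{B}^n=\{z\in\mathbb{C}^n:|z|^2<1\}$; $D^{IV}_m=\{Z\in\mathbb{C}^m: Z\overline{Z}^t<2,\ 1-Z\overline{Z}^t+\tfrac14|ZZ^t|^2>0\}$ (row vectors). A holomorphic map is proper if preimages of compact sets are compact. Maps $F_1,F_2:\mathbb{B}^n\to D^{IV}_m$ are equivalent if $F_1=\phi\circ F_2\circ\psi$ with $\psi$, $\phi$ biholomorphic automorphisms of $\mathbb{B}^n$, $D^{IV}_m$ respectively. A holomorphic map $F:\mathbb{B}^n\to D^{IV}_m$ is minimum if there is no holomorphic map $G:\mathbb{B}^n\to D^{IV}_{m-1}$ such that $F$ is equivalent to $(G,0)$. *)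

theory Defs
  imports "HOL-Analysis.Analysis"
begin

definition cball_unit :: "(complex^'n) set" where
  "cball_unit = {z. (\<Sum>i\<in>UNIV. (cmod (z $ i))^2) < 1}"

definition DIV :: "(complex^'m) set" where
  "DIV = {Z. (\<Sum>i\<in>UNIV. (cmod (Z $ i))^2) < 2 \<and>
             1 - (\<Sum>i\<in>UNIV. (cmod (Z $ i))^2) + (1/4) * (cmod (\<Sum>i\<in>UNIV. (Z $ i)^2))^2 > 0}"

definition cholo :: "(complex^'n) set \<Rightarrow> (complex^'n \<Rightarrow> complex^'m) \<Rightarrow> bool" where
  "cholo U F \<longleftrightarrow> (\<forall>z\<in>U. \<exists>L. (F has_derivative L) (at z) \<and> (\<forall>c x. L (c *s x) = c *s L x))"

definition proper_between :: "('a::topological_space) set \<Rightarrow> ('b::topological_space) set \<Rightarrow> ('a \<Rightarrow> 'b) \<Rightarrow> bool" where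
  "proper_between A B F \<longleftrightarrow> F ` A \<subseteq> B \<and> (\<forall>K. K \<subseteq> B \<and> compact K \<longrightarrow> compact (A \<inter> F -` K))"

definition biholo_aut :: "(complex^'n) set \<Rightarrow> (complex^'n \<Rightarrow> complex^'n) \<Rightarrow> bool" where
  "biholo_aut U \<phi> \<longleftrightarrow> bij_betw \<phi> U U \<and> cholo U \<phi> \<and> cholo U (inv_into U \<phi>)"

definition equivalent_maps :: "(complex^'n \<Rightarrow> complex^'m) \<Rightarrow> (complex^'n \<Rightarrow> complex^'m) \<Rightarrow> bool" where
  "equivalent_maps F1 F2 \<longleftrightarrow> (\<exists>\<psi> \<phi>. biholo_aut cball_unit \<psi> \<and> biholo_aut DIV \<phi> \<and>
      (\<forall>z\<in>cball_unit. F1 z = \<phi> (F2 (\<psi> z))))"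

text \<open>Minimum: F is not equivalent to any (G,0) with G holomorphic B^n -> D^IV_(m-1).
  (G,0) is represented as a holomorphic map into C^m whose last coordinate
  (index Max UNIV) vanishes; such a map takes values in D^IV_m iff G takes values
  in D^IV_(m-1).\<close>
definition minimum_map :: "(complex^'n \<Rightarrow> complex^('m::{finite,linorder})) \<Rightarrow> bool" where
  "minimum_map F \<longleftrightarrow> \<not> (\<exists>H :: complex^'n \<Rightarrow> complex^('m::{finite,linorder}).
      cholo cball_unit H \<and> H ` cball_unit \<subseteq> DIV \<and>
      (\<forall>z\<in>cball_unit. H z $ Max (UNIV :: ('m::{finite,linorder}) set) = 0) \<and> equivalent_maps F H)"

end

theory Submission
  imports Defs "HOL-Complex_Analysis.Complex_Analysis"
begin

text \<open>
  Minimality. Suppose F (0) = 0 and F is equivalent to a map into the hyperplane of the last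
  coordinate. The reflection in that hyperplane, conjugated by the automorphism of the equivalence,
  is an involution of the type IV domain that fixes every F (z), in particular 0. Let A be its
  derivative at 0. The domain lies in the Euclidean ball of radius sqrt 2 and contains the disc of
  that radius in each real direction, so the Schwarz lemma shows that A does not increase the norm
  of real vectors; with A o A = id this forces A to be unitary and self-adjoint. The equality case
  of the Schwarz lemma makes the involution equal to A on real vectors, hence near 0. Moreover A
  maps real vectors to phases of real vectors, so A is a phase times a real matrix, and the phase is
  1 as soon as some F (z) is not isotropic. Thus A fixes all F (z) and their conjugates, and if the
  components of F are linearly independent over the reals then A = id, which is absurd.

  Existence. Let g be a monomial proper map into a ball of dimension N with m between N + 1 and 2 N.
  Use some components g_q as they stand, split the others into g_q / sqrt 2 and i g_q / sqrt 2
  (independent over the reals, with vanishing sum of squares), and add one component h with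
  h^2 + s = 2 h, where s is the sum of the squares of the unsplit g_q. Then F F^t = 2 h, so the
  defining function of the type IV domain at F is 1 - |g|^2.
\<close>

no_notation fps_nth (infixl "$" 75)

section \<open>Hermitian form and complex linear maps\<close>

definition herm :: "complex^'m \<Rightarrow> complex^'m \<Rightarrow> complex" where
  "herm u w = (\<Sum>i\<in>UNIV. u $ i * cnj (w $ i))"

text \<open>\<open>herm Z (vcnj Z)\<close> is the bilinear square Z Z^t, so \<open>herm\<close>
  expresses both quantities in the definition of \<open>DIV\<close>.\<close>

definition vcnj :: "complex^'m \<Rightarrow> complex^'m" where
  "vcnj w = (\<chi> i. cnj (w $ i))"

definition complex_linear :: "(complex^'n \<Rightarrow> complex^'m) \<Rightarrow> bool" where
  "complex_linear L \<longleftrightarrow> linear L \<and> (\<forall>c x. L (c *s x) = c *s L x)"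

lemma norm_power2_vec: "(norm (u::complex^'m))\<^sup>2 = (\<Sum>i\<in>UNIV. (cmod (u $ i))\<^sup>2)"
  by (simp add: norm_vec_def L2_set_def sum_nonneg)

lemma herm_self: "herm u u = of_real ((norm u)\<^sup>2)"
  unfolding herm_def norm_power2_vec by (simp only: complex_norm_square of_real_sum)

lemma herm_add_left: "herm (u + v) w = herm u w + herm v w"
  by (simp add: herm_def algebra_simps sum.distrib)

lemma herm_diff_left: "herm (u - v) w = herm u w - herm v w"
  by (simp add: herm_def algebra_simps sum_subtractf)

lemma herm_diff_right: "herm w (u - v) = herm w u - herm w v"
  by (simp add: herm_def algebra_simps sum_subtractf)

lemma herm_smult_left: "herm (c *s u) w = c * herm u w"
  by (simp add: herm_def sum_distrib_left mult.assoc)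

lemma herm_smult_right: "herm u (c *s w) = cnj c * herm u w"
  by (simp add: herm_def sum_distrib_left algebra_simps)

lemma cnj_herm: "cnj (herm u w) = herm w u"
  by (simp add: herm_def mult.commute)

lemma herm_axis_right: "herm u (axis i 1) = u $ i"
proof -
  have "herm u (axis i 1) = (\<Sum>j\<in>UNIV. if j = i then u $ j else 0)"
    unfolding herm_def by (rule sum.cong) (auto simp: axis_def)
  then show ?thesis by simp
qed

lemma norm_herm_le: "cmod (herm u w) \<le> norm u * norm w"
proof -
  have "cmod (herm u w) \<le> (\<Sum>i\<in>UNIV. cmod (u $ i) * cmod (w $ i))"
    unfolding herm_def by (rule order_trans[OF norm_sum]) (simp add: norm_mult)
  also have "\<dots> \<le> norm u * norm w"
    using L2_set_mult_ineq[of "\<lambda>i. cmod (u $ i)" "\<lambda>i. cmod (w $ i)" UNIV]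
    by (simp add: norm_vec_def)
  finally show ?thesis .
qed

lemma norm_smult_vec: "norm (c *s (u::complex^'m)) = cmod c * norm u"
proof -
  have "(norm (c *s u))\<^sup>2 = (cmod c * norm u)\<^sup>2"
    by (simp add: norm_power2_vec norm_mult power_mult_distrib sum_distrib_left)
  then show ?thesis by (simp add: power2_eq_iff_nonneg)
qed

lemma norm_vcnj [simp]: "norm (vcnj u) = norm u"
  by (simp add: norm_vec_def vcnj_def)

lemma vcnj_vcnj [simp]: "vcnj (vcnj u) = u"
  by (simp add: vcnj_def vec_eq_iff)

lemma vcnj_smult: "vcnj (c *s u) = cnj c *s vcnj u"
  by (simp add: vcnj_def vec_eq_iff)

lemma vcnj_add: "vcnj (u + v) = vcnj u + vcnj v"
  by (simp add: vcnj_def vec_eq_iff)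

lemma norm_diff_power2_vec:
  "(norm (u - v))\<^sup>2 = (norm u)\<^sup>2 + (norm v)\<^sup>2 - 2 * Re (herm u v)"
proof -
  have "complex_of_real ((norm (u - v))\<^sup>2) =
      of_real ((norm u)\<^sup>2) + of_real ((norm v)\<^sup>2) - (herm u v + cnj (herm u v))"
    unfolding herm_self[symmetric] cnj_herm
    by (simp add: herm_diff_left herm_diff_right)
  then have "Re (complex_of_real ((norm (u - v))\<^sup>2)) =
      Re (of_real ((norm u)\<^sup>2) + of_real ((norm v)\<^sup>2) - (herm u v + cnj (herm u v)))"
    by (rule arg_cong)
  then show ?thesis by simp
qed

lemma complex_linear_add: "complex_linear L \<Longrightarrow> L (u + v) = L u + L v"
  by (simp add: complex_linear_def linear_add)

lemma complex_linear_smult: "complex_linear L \<Longrightarrow> L (c *s u) = c *s L u"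
  by (simp add: complex_linear_def)

lemma complex_linear_expansion:
  assumes "complex_linear L"
  shows "L u = (\<Sum>j\<in>UNIV. u $ j *s L (axis j 1))"
proof -
  have "L u = L (\<Sum>j\<in>UNIV. u $ j *s axis j 1)" by (simp add: basis_expansion)
  also have "\<dots> = (\<Sum>j\<in>UNIV. L (u $ j *s axis j 1))"
    using assms by (simp add: complex_linear_def linear_sum)
  finally show ?thesis by (simp add: complex_linear_smult[OF assms])
qed

lemma cholo_derivative:
  assumes "cholo U F" "z \<in> U"
  obtains L where "(F has_derivative L) (at z)" "complex_linear L"
  using assms unfolding cholo_def complex_linear_def
  by (meson has_derivative_linear)

section \<open>Slices by complex lines and a vector-valued Schwarz lemma\<close>

lemma bounded_linear_herm_left: "bounded_linear (\<lambda>u. herm u w)"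
proof (rule bounded_linear_intro[of _ "norm w"])
  fix u v :: "complex^'a" and r :: real
  show "herm (u + v) w = herm u w + herm v w" by (rule herm_add_left)
  show "herm (r *\<^sub>R u) w = r *\<^sub>R herm u w"
    by (simp add: herm_def scaleR_sum_right)
  show "norm (herm u w) \<le> norm u * norm w" by (rule norm_herm_le)
qed

lemma bounded_linear_smult_right: "bounded_linear (\<lambda>c. c *s (b::complex^'m))"
proof (rule bounded_linear_intro[of _ "norm b"])
  fix c d :: complex and r :: real
  show "(c + d) *s b = c *s b + d *s b" by (simp add: vec_eq_iff algebra_simps)
  show "(r *\<^sub>R c) *s b = r *\<^sub>R (c *s b)" by (simp add: vec_eq_iff)
  show "norm (c *s b) \<le> norm c * norm b" by (simp add: norm_smult_vec)
qed

lemma has_field_derivative_herm_slice: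
  assumes "(F has_derivative L) (at (a + c *s b))" "complex_linear L"
  shows "((\<lambda>\<zeta>. herm (F (a + \<zeta> *s b)) w) has_field_derivative herm (L b) w) (at c)"
proof -
  have "((\<lambda>\<zeta>. a + \<zeta> *s b) has_derivative (\<lambda>\<zeta>. \<zeta> *s b)) (at c)"
    using has_derivative_add[OF has_derivative_const
        bounded_linear_imp_has_derivative[OF bounded_linear_smult_right[of b]], of a "at c"]
    by simp
  then have "((\<lambda>\<zeta>. F (a + \<zeta> *s b)) has_derivative (\<lambda>\<zeta>. L (\<zeta> *s b))) (at c)"
    using assms(1) by (rule has_derivative_compose)
  then have "((\<lambda>\<zeta>. herm (F (a + \<zeta> *s b)) w) has_derivative (\<lambda>\<zeta>. herm (L (\<zeta> *s b)) w)) (at c)"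
    by (rule bounded_linear.has_derivative[OF bounded_linear_herm_left])
  moreover have "(\<lambda>\<zeta>. herm (L (\<zeta> *s b)) w) = (*) (herm (L b) w)"
    by (simp add: complex_linear_smult[OF assms(2)] herm_smult_left fun_eq_iff mult.commute)
  ultimately show ?thesis by (simp add: has_field_derivative_def)
qed

lemma cholo_slice_holomorphic:
  assumes "cholo U F" "\<And>\<zeta>. \<zeta> \<in> S \<Longrightarrow> a + \<zeta> *s b \<in> U"
  shows "(\<lambda>\<zeta>. herm (F (a + \<zeta> *s b)) w) holomorphic_on S"
  unfolding holomorphic_on_def field_differentiable_def
proof
  fix c assume "c \<in> S"
  then obtain L where "(F has_derivative L) (at (a + c *s b))" "complex_linear L"
    using assms cholo_derivative by blast
  from has_field_derivative_herm_slice[OF this]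
  show "\<exists>f'. ((\<lambda>\<zeta>. herm (F (a + \<zeta> *s b)) w) has_field_derivative f') (at c within S)"
    using has_field_derivative_at_within by blast
qed

text \<open>Pairing \<open>F\<close> with a unit vector reduces both claims to the Schwarz lemma on
  the disc. In the equality case the pairing with the direction of \<open>L b\<close> is exactly
  linear, and the growth bound on the norm of \<open>F\<close> leaves no room for an orthogonal
  part.\<close>

lemma schwarz_lemma_vector:
  fixes F :: "complex^'n \<Rightarrow> complex^'m"
  assumes hol: "cholo U F" and U: "\<And>\<zeta>. cmod \<zeta> < 1 \<Longrightarrow> \<zeta> *s b \<in> U"
    and F0: "F 0 = 0" and L: "(F has_derivative L) (at 0)" "complex_linear L"
    and R: "R > 0" and bd: "\<And>z. z \<in> U \<Longrightarrow> norm (F z) < R"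
  shows "norm (L b) \<le> R"
    and "norm (L b) = R \<Longrightarrow> cmod \<zeta> < 1 \<Longrightarrow> F (\<zeta> *s b) = \<zeta> *s L b"
proof -
  have *: "(\<lambda>\<zeta>. herm (F (\<zeta> *s b)) w / of_real R) holomorphic_on ball 0 1"
    "herm (F (0 *s b)) w / of_real R = 0"
    "\<And>\<zeta>. cmod \<zeta> < 1 \<Longrightarrow> cmod (herm (F (\<zeta> *s b)) w / of_real R) < 1"
    "deriv (\<lambda>\<zeta>. herm (F (\<zeta> *s b)) w / of_real R) 0 = herm (L b) w / of_real R"
    if w: "norm w = 1" for w
  proof -
    have "(\<lambda>\<zeta>. herm (F (0 + \<zeta> *s b)) w) holomorphic_on ball 0 1"
      by (rule cholo_slice_holomorphic[OF hol]) (use U in auto)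
    then show "(\<lambda>\<zeta>. herm (F (\<zeta> *s b)) w / of_real R) holomorphic_on ball 0 1"
      using R by (auto intro!: holomorphic_intros)
    show "herm (F (0 *s b)) w / of_real R = 0" by (simp add: F0 herm_def)
    show "cmod (herm (F (\<zeta> *s b)) w / of_real R) < 1" if "cmod \<zeta> < 1" for \<zeta>
    proof -
      have "cmod (herm (F (\<zeta> *s b)) w) \<le> norm (F (\<zeta> *s b))"
        using norm_herm_le[of "F (\<zeta> *s b)" w] w by simp
      also have "\<dots> < R" using bd U that by blast
      finally show ?thesis using R by (simp add: norm_divide)
    qed
    have "((\<lambda>\<zeta>. herm (F (0 + \<zeta> *s b)) w) has_field_derivative herm (L b) w) (at 0)"
      by (rule has_field_derivative_herm_slice) (use L in auto)
    then have "((\<lambda>\<zeta>. herm (F (\<zeta> *s b)) w / of_real R) has_field_derivative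
        herm (L b) w / of_real R) (at 0)"
      by (simp add: DERIV_cdivide)
    then show "deriv (\<lambda>\<zeta>. herm (F (\<zeta> *s b)) w / of_real R) 0 = herm (L b) w / of_real R"
      by (rule DERIV_imp_deriv)
  qed
  \<comment> \<open>The norm of \<open>v\<close> is attained by pairing with \<open>v\<close>
    itself, normalized.\<close>
  have bound: "norm v \<le> K" if "\<And>w. norm w = 1 \<Longrightarrow> cmod (herm v w) \<le> K" "K \<ge> 0"
    for v :: "complex^'m" and K
  proof (cases "v = 0")
    case False
    define w where "w = of_real (1 / norm v) *s v"
    have "norm w = 1" using False by (simp add: w_def norm_smult_vec norm_divide)
    moreover have "herm v w = of_real (norm v)"
      using False by (simp add: w_def herm_smult_right herm_self power2_eq_square)
    ultimately show ?thesis using that(1)[of w] by simp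
  qed (use that in simp)
  show le: "norm (L b) \<le> R"
  proof (rule bound)
    fix w :: "complex^'m" assume w: "norm w = 1"
    have "cmod (deriv (\<lambda>\<zeta>. herm (F (\<zeta> *s b)) w / of_real R) 0) \<le> 1"
      by (rule Schwarz_Lemma(2)[OF *(1,2,3)[OF w], of 0]) auto
    then show "cmod (herm (L b) w) \<le> R"
      unfolding *(4)[OF w] using R by (simp add: norm_divide)
  qed (use R in simp)
  assume eq: "norm (L b) = R" and \<zeta>: "cmod \<zeta> < 1"
  have growth: "norm (F (\<zeta> *s b)) \<le> R * cmod \<zeta>"
  proof (rule bound)
    fix w :: "complex^'m" assume w: "norm w = 1"
    have "cmod (herm (F (\<zeta> *s b)) w / of_real R) \<le> cmod \<zeta>"
      by (rule Schwarz_Lemma(1)[OF *(1,2,3)[OF w] \<zeta>]) auto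
    then show "cmod (herm (F (\<zeta> *s b)) w) \<le> R * cmod \<zeta>"
      using R by (simp add: norm_divide field_simps)
  qed (use R in simp)
  define w where "w = of_real (1 / R) *s L b"
  have w: "norm w = 1" using eq R by (simp add: w_def norm_smult_vec norm_divide)
  have hw: "herm (L b) w = of_real R"
    using R eq by (simp add: w_def herm_smult_right herm_self power2_eq_square)
  have d1: "deriv (\<lambda>\<zeta>. herm (F (\<zeta> *s b)) w / of_real R) 0 = 1"
    unfolding *(4)[OF w] hw using R by simp
  obtain \<alpha> where \<alpha>: "\<And>z. cmod z < 1 \<Longrightarrow> herm (F (z *s b)) w / of_real R = \<alpha> * z"
    using Schwarz_Lemma(3)[OF *(1,2,3)[OF w], of 0] d1 by auto
  have "((\<lambda>\<zeta>. herm (F (\<zeta> *s b)) w / of_real R) has_field_derivative \<alpha>) (at 0)"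
  proof (rule has_field_derivative_transform_within_open[of "\<lambda>z. \<alpha> * z" _ _ "ball 0 1"])
    show "((*) \<alpha> has_field_derivative \<alpha>) (at 0)"
      by (auto intro!: derivative_eq_intros)
  qed (use \<alpha> in auto)
  then have "\<alpha> = 1" using d1 DERIV_imp_deriv by metis
  then have hF: "herm (F (\<zeta> *s b)) w = of_real R * \<zeta>"
    using \<alpha>[OF \<zeta>] R by (simp add: field_simps)
  have Lb: "L b = of_real R *s w" using R by (simp add: w_def vec_eq_iff)
  \<comment> \<open>This inner product equals R^2 |\<zeta>|^2, while both vectors have norm at most
    R |\<zeta>|; expanding the squared distance shows that they coincide.\<close>
  have h2: "herm (F (\<zeta> *s b)) (\<zeta> *s L b) = of_real (R\<^sup>2 * (cmod \<zeta>)\<^sup>2)"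
    unfolding Lb herm_smult_right hF of_real_mult complex_norm_square power2_eq_square[of R]
    by (simp add: mult_ac)
  have "(norm (F (\<zeta> *s b) - \<zeta> *s L b))\<^sup>2 =
      (norm (F (\<zeta> *s b)))\<^sup>2 + (cmod \<zeta> * R)\<^sup>2 - 2 * (R\<^sup>2 * (cmod \<zeta>)\<^sup>2)"
    unfolding norm_diff_power2_vec h2 norm_smult_vec eq by simp
  also have "(norm (F (\<zeta> *s b)))\<^sup>2 \<le> (R * cmod \<zeta>)\<^sup>2"
    using growth by (intro power_mono) auto
  finally have "(norm (F (\<zeta> *s b) - \<zeta> *s L b))\<^sup>2 \<le> 0"
    by (simp add: power_mult_distrib)
  then show "F (\<zeta> *s b) = \<zeta> *s L b" by simp
qed

text \<open>For the matrix a of \<open>A\<close>, the squared Frobenius norm of a - a^* is twice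
  that of a minus 2 Re tr(a a). The columns bound the former by twice the dimension, and a a = 1
  makes the latter equal to twice the dimension.\<close>

lemma involution_self_adjoint:
  fixes A :: "complex^'m \<Rightarrow> complex^'m"
  assumes A: "complex_linear A" and inv: "\<And>u. A (A u) = u"
    and le: "\<And>i. norm (A (axis i 1)) \<le> 1"
  shows "herm (A u) w = herm u (A w)"
proof -
  define a where "a i j = A (axis j 1) $ i" for i j
  have A_nth: "A v $ i = (\<Sum>j\<in>UNIV. a i j * v $ j)" for v i
    by (subst complex_linear_expansion[OF A]) (simp add: a_def sum_component mult.commute)
  have frob: "(\<Sum>j\<in>UNIV. \<Sum>i\<in>UNIV. (cmod (a i j))\<^sup>2) \<le> real CARD('m)"
  proof -
    have "(\<Sum>i\<in>UNIV. (cmod (a i j))\<^sup>2) \<le> 1" for j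
      using le[of j] unfolding a_def norm_power2_vec[symmetric] by (simp add: power_le_one)
    then show ?thesis using sum_mono[of UNIV "\<lambda>j. \<Sum>i\<in>UNIV. (cmod (a i j))\<^sup>2" "\<lambda>_. 1"] by simp
  qed
  have tr: "(\<Sum>j\<in>UNIV. \<Sum>i\<in>UNIV. a j i * a i j) = of_nat CARD('m)"
  proof -
    have "(\<Sum>i\<in>UNIV. a j i * a i j) = A (A (axis j 1)) $ j" for j
      unfolding A_nth[of "A (axis j 1)"] by (simp add: a_def)
    then show ?thesis by (simp add: inv)
  qed
  have sq: "(cmod (x - cnj y))\<^sup>2 = (cmod x)\<^sup>2 + (cmod y)\<^sup>2 - 2 * Re (y * x)" for x y
    unfolding cmod_power2 by (simp add: power2_eq_square algebra_simps)
  have "(\<Sum>j\<in>UNIV. \<Sum>i\<in>UNIV. (cmod (a i j - cnj (a j i)))\<^sup>2) =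
      (\<Sum>j\<in>UNIV. \<Sum>i\<in>UNIV. (cmod (a i j))\<^sup>2) + (\<Sum>j\<in>UNIV. \<Sum>i\<in>UNIV. (cmod (a j i))\<^sup>2)
      - 2 * Re (\<Sum>j\<in>UNIV. \<Sum>i\<in>UNIV. a j i * a i j)"
    unfolding sq by (simp add: sum.distrib sum_subtractf sum_distrib_left)
  also have "(\<Sum>j\<in>UNIV. \<Sum>i\<in>UNIV. (cmod (a j i))\<^sup>2) = (\<Sum>j\<in>UNIV. \<Sum>i\<in>UNIV. (cmod (a i j))\<^sup>2)"
    by (rule sum.swap)
  finally have "(\<Sum>j\<in>UNIV. \<Sum>i\<in>UNIV. (cmod (a i j - cnj (a j i)))\<^sup>2) \<le> 0"
    using frob unfolding tr by simp
  then have "(\<Sum>j\<in>UNIV. \<Sum>i\<in>UNIV. (cmod (a i j - cnj (a j i)))\<^sup>2) = 0"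
    by (rule antisym) (intro sum_nonneg zero_le_power2)
  then have "(\<Sum>i\<in>UNIV. (cmod (a i j - cnj (a j i)))\<^sup>2) = 0" for j
    by (subst (asm) sum_nonneg_eq_0_iff) (auto intro: sum_nonneg)
  then have "(cmod (a i j - cnj (a j i)))\<^sup>2 = 0" for i j
    using sum_nonneg_eq_0_iff[of UNIV "\<lambda>i. (cmod (a i j - cnj (a j i)))\<^sup>2"] by auto
  then have sym: "a i j = cnj (a j i)" for i j
    by (metis norm_eq_zero power_eq_0_iff right_minus_eq)
  have "herm (A u) w = (\<Sum>i\<in>UNIV. \<Sum>j\<in>UNIV. a i j * u $ j * cnj (w $ i))"
    unfolding herm_def A_nth by (simp add: sum_distrib_right)
  also have "\<dots> = (\<Sum>j\<in>UNIV. \<Sum>i\<in>UNIV. a i j * u $ j * cnj (w $ i))"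
    by (rule sum.swap)
  also have "\<dots> = herm u (A w)"
    unfolding herm_def A_nth cnj_sum sum_distrib_left
    by (intro sum.cong refl) (subst sym, simp add: mult_ac)
  finally show ?thesis .
qed

section \<open>Type IV domains and their involutions\<close>

lemma DIV_iff: "Z \<in> DIV \<longleftrightarrow> (norm Z)\<^sup>2 < 2 \<and>
    1 - (norm Z)\<^sup>2 + (1/4) * (cmod (herm Z (vcnj Z)))\<^sup>2 > 0"
  by (simp add: DIV_def norm_power2_vec herm_def vcnj_def flip: power2_eq_square)

lemma open_DIV: "open (DIV :: (complex^'m) set)"
  unfolding DIV_def
  by (intro open_Collect_conj open_Collect_less continuous_intros)

lemma ball_subset_DIV: "norm Z < 1 \<Longrightarrow> Z \<in> DIV"
  unfolding DIV_iff using power_strict_mono[of "norm Z" 1 2] by (auto intro: add_pos_nonneg)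

lemma DIV_norm_less: "Z \<in> DIV \<Longrightarrow> norm Z < sqrt 2"
  unfolding DIV_iff by (simp add: real_less_rsqrt)

text \<open>With t = |\<zeta>|^2 the defining function on such a disc is the perfect square (1 -
  t)^2.\<close>

lemma real_direction_in_DIV:
  assumes "vcnj x = x" "norm x = sqrt 2" "cmod \<zeta> < 1"
  shows "\<zeta> *s x \<in> DIV"
proof -
  define t where "t = (cmod \<zeta>)\<^sup>2"
  have t: "t < 1" using assms(3) by (simp add: t_def power_less_one_iff)
  have n: "(norm (\<zeta> *s x))\<^sup>2 = 2 * t"
    using assms by (simp add: norm_smult_vec power_mult_distrib t_def)
  have "herm (\<zeta> *s x) (vcnj (\<zeta> *s x)) = \<zeta>\<^sup>2 * of_real ((norm x)\<^sup>2)"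
    by (simp add: vcnj_smult assms(1) herm_smult_left herm_smult_right herm_self power2_eq_square)
  then have "cmod (herm (\<zeta> *s x) (vcnj (\<zeta> *s x))) = 2 * t"
    using assms(2) by (simp add: norm_mult norm_power t_def)
  moreover have "0 < (1 - t)\<^sup>2" using t by simp
  ultimately show ?thesis unfolding DIV_iff n using t by (simp add: power2_eq_square algebra_simps)
qed

text \<open>Letting \<zeta> tend to 1 along the reals, positivity of the defining function passes to
  the limit 1 - 2 + \<beta>^2 / 4. This is a converse to \<open>real_direction_in_DIV\<close>: it
  will put \<open>w\<close> in the equality case of Cauchy-Schwarz.\<close>

lemma herm_vcnj_ge_of_disc_in_DIV:
  assumes w: "norm w = sqrt 2" and D: "\<And>\<zeta>. cmod \<zeta> < 1 \<Longrightarrow> \<zeta> *s w \<in> DIV"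
  shows "cmod (herm w (vcnj w)) \<ge> 2"
proof -
  define \<beta> where "\<beta> = cmod (herm w (vcnj w))"
  define f where "f t = 1 - 2 * t\<^sup>2 + (1/4) * (t\<^sup>2 * \<beta>)\<^sup>2" for t :: real
  have f: "f t > 0" if "0 < t" "t < 1" for t
  proof -
    have "cmod (herm (of_real t *s w) (vcnj (of_real t *s w))) = t\<^sup>2 * \<beta>"
      by (simp add: vcnj_smult herm_smult_left herm_smult_right \<beta>_def norm_mult power2_eq_square)
    moreover have "of_real t *s w \<in> DIV" using D that by simp
    ultimately show ?thesis
      using w that unfolding DIV_iff f_def by (simp add: norm_smult_vec power_mult_distrib mult.commute)
  qed
  have "continuous (at_left 1) f" unfolding f_def by (intro continuous_intros)
  then have "(f \<longlongrightarrow> f 1) (at_left 1)" by (simp add: continuous_within)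
  moreover have "\<forall>\<^sub>F t in at_left 1. 0 \<le> f t"
    unfolding eventually_at_left_field by (rule exI[of _ 0]) (auto intro: less_imp_le f)
  ultimately have "0 \<le> f 1" by (rule tendsto_lowerbound) simp
  then have "2\<^sup>2 \<le> \<beta>\<^sup>2" by (simp add: f_def)
  then show ?thesis unfolding \<beta>_def by (rule power2_le_imp_le) simp
qed

text \<open>Equality in the Cauchy--Schwarz inequality for w and its conjugate.\<close>
lemma phase_of_real_vector:
  assumes "cmod (herm w (vcnj w)) \<ge> (norm w)\<^sup>2" "w \<noteq> 0"
  obtains \<beta> where "\<beta> \<noteq> 0" "w = \<beta> *s vcnj w"
proof -
  define \<beta> where "\<beta> = herm w (vcnj w) / of_real ((norm w)\<^sup>2)"
  have \<beta>: "cmod \<beta> \<ge> 1" using assms unfolding \<beta>_def norm_divide norm_of_real by simp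
  have "herm w (vcnj w) = \<beta> * of_real ((norm w)\<^sup>2)" using assms(2) by (simp add: \<beta>_def)
  then have "herm w (\<beta> *s vcnj w) = of_real ((cmod \<beta>)\<^sup>2 * (norm w)\<^sup>2)"
    by (simp only: herm_smult_right of_real_mult complex_norm_square mult_ac)
  then have "(norm (w - \<beta> *s vcnj w))\<^sup>2 = (norm w)\<^sup>2 * (1 - (cmod \<beta>)\<^sup>2)"
    unfolding norm_diff_power2_vec by (simp add: norm_smult_vec power_mult_distrib algebra_simps)
  also have "\<dots> \<le> 0" using \<beta> by (intro mult_nonneg_nonpos) auto
  finally have "w = \<beta> *s vcnj w" by simp
  moreover have "\<beta> \<noteq> 0" using \<beta> by auto
  ultimately show ?thesis using that by blast
qed

text \<open>The basis vectors are real, hence eigenvectors; so are their pairwise sums, which forces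
  the eigenvalues to agree.\<close>

lemma scalar_of_real_eigenvectors:
  fixes T :: "complex^'m \<Rightarrow> complex^'m"
  assumes T: "complex_linear T" and eig: "\<And>x. vcnj x = x \<Longrightarrow> \<exists>c. T x = c *s x"
  shows "\<exists>c. \<forall>u. T u = c *s u"
proof -
  have ax: "vcnj (axis i 1) = axis i (1::complex)" for i :: 'm
    by (simp add: vcnj_def axis_def vec_eq_iff)
  obtain c where c: "\<And>i. T (axis i 1) = c i *s axis i 1"
    using eig[OF ax] by metis
  have cc: "c i = c j" for i j
  proof (cases "i = j")
    case False
    obtain d where d: "T (axis i 1 + axis j 1) = d *s (axis i 1 + axis j 1)"
      using eig[of "axis i 1 + axis j 1"] by (auto simp: vcnj_add ax)
    then have e: "c i *s axis i 1 + c j *s axis j 1 = d *s (axis i 1 + axis j 1)"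
      by (simp add: complex_linear_add[OF T] c)
    have "c i = d" using arg_cong[OF e, of "\<lambda>v. v $ i"] False by (simp add: axis_def)
    moreover have "c j = d" using arg_cong[OF e, of "\<lambda>v. v $ j"] False by (simp add: axis_def)
    ultimately show ?thesis by simp
  qed simp
  \<comment> \<open>All eigenvalues agree, so any index serves.\<close>
  define d where "d = c undefined"
  have "T u = d *s u" for u
  proof -
    have "T u = (\<Sum>j\<in>UNIV. u $ j *s (d *s axis j 1))"
      unfolding complex_linear_expansion[OF T, of u] c d_def by (metis cc)
    also have "\<dots> = d *s (\<Sum>j\<in>UNIV. u $ j *s axis j 1)"
      by (simp add: vec_eq_iff sum_component sum_distrib_left mult_ac)
    finally show ?thesis by (simp add: basis_expansion)
  qed
  then show ?thesis by blast
qed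

text \<open>The hypotheses say that the linear isometry A maps real vectors to phases of real
  vectors, so it is a phase times a real matrix; the fixed vector excludes a nontrivial phase.\<close>
lemma fixes_conjugate_of_fixed:
  fixes A :: "complex^'m \<Rightarrow> complex^'m"
  assumes A: "complex_linear A" and inv: "\<And>u. A (A u) = u"
    and adj: "\<And>u w. herm (A u) w = herm u (A w)"
    and real: "\<And>x. vcnj x = x \<Longrightarrow> x \<noteq> 0 \<Longrightarrow> \<exists>\<beta>. \<beta> \<noteq> 0 \<and> A x = \<beta> *s vcnj (A x)"
    and v0: "A v0 = v0" "herm v0 (vcnj v0) \<noteq> 0" and v: "A v = v"
  shows "A (vcnj v) = vcnj v"
proof -
  \<comment> \<open>The two conjugations cancel, so \<open>T\<close> is complex linear. The phase
    condition on \<open>A x\<close> together with \<open>inv\<close> makes every real vector an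
    eigenvector of \<open>T\<close>, so \<open>T\<close> is a scalar.\<close>
  define T where "T u = vcnj (A (vcnj (A u)))" for u
  have T: "complex_linear T"
    unfolding complex_linear_def T_def
  proof (intro conjI allI linearI)
    fix u w :: "complex^'m" and r :: real and c
    show "vcnj (A (vcnj (A (u + w)))) = vcnj (A (vcnj (A u))) + vcnj (A (vcnj (A w)))"
      by (simp add: complex_linear_add[OF A] vcnj_add)
    show smult: "vcnj (A (vcnj (A (c *s u)))) = c *s vcnj (A (vcnj (A u)))" for c
      by (simp add: complex_linear_smult[OF A] vcnj_smult)
    have "r *\<^sub>R w = complex_of_real r *s w" for w :: "complex^'m"
      unfolding vec_eq_iff vector_scaleR_component vector_smult_component
      by (simp add: scaleR_conv_of_real)
    then show "vcnj (A (vcnj (A (r *\<^sub>R u)))) = r *\<^sub>R vcnj (A (vcnj (A u)))"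
      using smult by simp
  qed
  have "\<exists>c. T x = c *s x" if x: "vcnj x = x" for x
  proof (cases "x = 0")
    case True
    then have "T x = 0 *s x" using complex_linear_smult[OF T, of 0 x] by simp
    then show ?thesis by blast
  next
    case False
    then obtain \<beta> where \<beta>: "\<beta> \<noteq> 0" "A x = \<beta> *s vcnj (A x)" using real x by blast
    have "vcnj (A x) = inverse \<beta> *s (\<beta> *s vcnj (A x))" using \<beta>(1) by (simp add: vec_eq_iff)
    also have "\<dots> = inverse \<beta> *s A x" using \<beta>(2) by simp
    finally have "A (vcnj (A x)) = inverse \<beta> *s x"
      by (simp add: complex_linear_smult[OF A] inv)
    then have "T x = cnj (inverse \<beta>) *s x" by (simp add: T_def vcnj_smult x)
    then show ?thesis by blast
  qed
  then obtain c where c: "\<And>u. T u = c *s u" using scalar_of_real_eigenvectors[OF T] by blast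
  have conj: "A (vcnj u) = cnj c *s vcnj u" if "A u = u" for u
    using arg_cong[OF c[of u], of vcnj] that by (simp add: T_def vcnj_smult)
  \<comment> \<open>Self-adjointness moves \<open>A\<close> onto the fixed vector \<open>v0\<close>;
    since \<open>v0\<close> is not isotropic, the scalar can be cancelled.\<close>
  have "cnj c * herm (vcnj v0) v0 = herm (vcnj v0) v0"
    using adj[of "vcnj v0" v0] conj[OF v0(1)] v0(1) by (simp add: herm_smult_left)
  moreover have "herm (vcnj v0) v0 \<noteq> 0" using v0(2) cnj_herm complex_cnj_zero_iff by metis
  ultimately have "cnj c = 1" by simp
  then show ?thesis using conj[OF v] by simp
qed

text \<open>Write z = x + i y with x and y real. The difference of \<open>\<sigma>\<close> and
  \<open>A\<close> at x + \<zeta> y is holomorphic in \<zeta> and vanishes for real \<zeta> near 0,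
  so the identity theorem carries the vanishing to \<zeta> = i.\<close>

lemma linear_near_0_of_linear_on_real_lines:
  fixes \<sigma> :: "complex^'m \<Rightarrow> complex^'m"
  assumes hol: "cholo DIV \<sigma>" and A: "complex_linear A"
    and real: "\<And>x. vcnj x = x \<Longrightarrow> norm x < 1 \<Longrightarrow> \<sigma> x = A x"
    and z: "norm z < 1/3"
  shows "\<sigma> z = A z"
proof -
  define x where "x = (\<chi> i. complex_of_real (Re (z $ i)))"
  define y where "y = (\<chi> i. complex_of_real (Im (z $ i)))"
  have zxy: "z = x + \<i> *s y"
    by (simp add: x_def y_def vec_eq_iff complex_eq_iff)
  have real_xy: "vcnj x = x" "vcnj y = y" by (simp_all add: x_def y_def vcnj_def vec_eq_iff)
  have nx: "norm x \<le> norm z" and ny: "norm y \<le> norm z"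
    unfolding norm_vec_def x_def y_def
    by (intro L2_set_mono; simp add: abs_Re_le_cmod abs_Im_le_cmod)+
  \<comment> \<open>Radius 2 lets the disc contain i; the norm is then at most 3 times that of
    \<open>z\<close>, whence the bound 1/3.\<close>
  have small: "norm (x + \<zeta> *s y) < 1" if "cmod \<zeta> < 2" for \<zeta>
  proof -
    have "norm (x + \<zeta> *s y) \<le> norm x + cmod \<zeta> * norm y"
      using norm_triangle_ineq[of x "\<zeta> *s y"] by (simp add: norm_smult_vec)
    also have "\<dots> \<le> norm z + 2 * norm z"
      using that nx ny by (intro add_mono mult_mono) auto
    finally show ?thesis using z by simp
  qed
  have "\<sigma> z $ k = A z $ k" for k
  proof -
    define f where "f \<zeta> = herm (\<sigma> (x + \<zeta> *s y)) (axis k 1) - (A x $ k + \<zeta> * A y $ k)" for \<zeta>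
    have f: "f \<zeta> = \<sigma> (x + \<zeta> *s y) $ k - A (x + \<zeta> *s y) $ k" for \<zeta>
      by (simp add: f_def herm_axis_right complex_linear_add[OF A] complex_linear_smult[OF A])
    have "f holomorphic_on ball 0 2"
      unfolding f_def
      by (intro holomorphic_intros cholo_slice_holomorphic[OF hol] ball_subset_DIV small) simp
    moreover have "f \<zeta> = 0" if \<zeta>: "\<zeta> \<in> complex_of_real ` {-1<..<1}" for \<zeta>
    proof -
      obtain t where t: "\<zeta> = of_real t" "-1 < t" "t < 1" using \<zeta> by auto
      have "\<sigma> (x + \<zeta> *s y) = A (x + \<zeta> *s y)"
        using t by (intro real small) (auto simp: vcnj_add vcnj_smult real_xy)
      then show ?thesis by (simp add: f)
    qed
    moreover have "(0::complex) islimpt complex_of_real ` {-1<..<1::real}"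
    proof -
      have "\<exists>t\<in>{-1<..<1::real}. complex_of_real t \<noteq> 0 \<and> cmod (of_real t) < e" if "e > 0" for e
        using that by (intro bexI[of _ "min e 1 / 2"]) auto
      then show ?thesis by (auto simp: islimpt_approachable)
    qed
    moreover have "complex_of_real ` {-1<..<1} \<subseteq> ball 0 2" by auto
    ultimately have "f \<i> = 0"
      using analytic_continuation[of f "ball 0 2" "complex_of_real ` {-1<..<1}" 0 \<i>] by simp
    then show ?thesis unfolding f zxy[symmetric] by simp
  qed
  then show ?thesis by (simp add: vec_eq_iff)
qed

text \<open>Real vectors of norm sqrt 2 span discs inside the domain, and the domain lies in the
  ball of that radius. Schwarz thus bounds \<open>A\<close> on basis vectors, \<open>A\<close> is a
  self-adjoint involution and so an isometry, and every such disc falls in the equality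
  case.\<close>

lemma DIV_involution:
  fixes \<sigma> A :: "complex^'m \<Rightarrow> complex^'m"
  assumes hol: "cholo DIV \<sigma>" and self: "\<And>Z. Z \<in> DIV \<Longrightarrow> \<sigma> Z \<in> DIV" and \<sigma>0: "\<sigma> 0 = 0"
    and d: "(\<sigma> has_derivative A) (at 0)" and A: "complex_linear A" and inv: "\<And>u. A (A u) = u"
  shows "herm (A u) w = herm u (A w)"
    and "vcnj x = x \<Longrightarrow> x \<noteq> 0 \<Longrightarrow> \<exists>\<beta>. \<beta> \<noteq> 0 \<and> A x = \<beta> *s vcnj (A x)"
    and "norm z < 1/3 \<Longrightarrow> \<sigma> z = A z"
proof -
  have le: "norm (A b) \<le> sqrt 2" if "vcnj b = b" "norm b = sqrt 2" for b
    by (rule schwarz_lemma_vector(1)[OF hol _ \<sigma>0 d A])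
      (use that in \<open>auto intro: real_direction_in_DIV DIV_norm_less self\<close>)
  have adj: "herm (A u) w = herm u (A w)" for u w
  proof (rule involution_self_adjoint[OF A inv])
    fix i :: 'm
    define b :: "complex^'m" where "b = of_real (sqrt 2) *s axis i 1"
    have "norm (A b) \<le> sqrt 2"
    proof (rule le)
      show "vcnj b = b" by (simp add: b_def vcnj_def vec_eq_iff axis_def)
      show "norm b = sqrt 2" by (simp add: b_def norm_smult_vec)
    qed
    then show "norm (A (axis i 1)) \<le> 1"
      by (simp add: b_def complex_linear_smult[OF A] norm_smult_vec)
  qed
  show "herm (A u) w = herm u (A w)" by (rule adj)
  have iso: "norm (A u) = norm u" for u
  proof -
    have "complex_of_real ((norm (A u))\<^sup>2) = of_real ((norm u)\<^sup>2)"
      unfolding herm_self[symmetric] adj inv ..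
    then show ?thesis by (simp only: of_real_eq_iff) simp
  qed
  \<comment> \<open>The isometry property supplies the equality
    \<open>norm (A b) = sqrt 2\<close>.\<close>
  have lin: "\<sigma> (\<zeta> *s b) = \<zeta> *s A b" if "vcnj b = b" "norm b = sqrt 2" "cmod \<zeta> < 1" for b \<zeta>
    by (rule schwarz_lemma_vector(2)[OF hol _ \<sigma>0 d A, where R = "sqrt 2"])
      (use that iso in \<open>auto intro: real_direction_in_DIV DIV_norm_less self\<close>)
  have scale: "\<exists>b r. vcnj b = b \<and> norm b = sqrt 2 \<and> r > 0 \<and> norm x = r * sqrt 2 \<and>
      x = complex_of_real r *s b" if "vcnj x = x" "x \<noteq> 0" for x :: "complex^'m"
  proof (intro exI conjI)
    let ?r = "norm x / sqrt 2" and ?b = "complex_of_real (sqrt 2 / norm x) *s x"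
    show "vcnj ?b = ?b" by (simp add: vcnj_smult that)
    show "norm ?b = sqrt 2" using that by (simp add: norm_smult_vec norm_divide)
    show "x = complex_of_real ?r *s ?b" using that by (simp add: vec_eq_iff)
  qed (use that in auto)
  show "\<exists>\<beta>. \<beta> \<noteq> 0 \<and> A x = \<beta> *s vcnj (A x)" if x: "vcnj x = x" "x \<noteq> 0"
  proof -
    obtain b r where b: "vcnj b = b" "norm b = sqrt 2" "x = complex_of_real r *s b"
      using scale[OF x] by blast
    \<comment> \<open>The image disc stays in the domain, so \<open>A b\<close> is extremal in the
      same sense as a real vector.\<close>
    have "\<zeta> *s A b \<in> DIV" if "cmod \<zeta> < 1" for \<zeta>
      using lin[OF b(1,2) that] self[OF real_direction_in_DIV[OF b(1,2) that]] by simp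
    then have "cmod (herm (A b) (vcnj (A b))) \<ge> (norm (A b))\<^sup>2"
      using herm_vcnj_ge_of_disc_in_DIV[of "A b"] iso b(2) by simp
    moreover have "A b \<noteq> 0" using iso[of b] b(2) by auto
    ultimately obtain \<beta> where \<beta>: "\<beta> \<noteq> 0" "A b = \<beta> *s vcnj (A b)" using phase_of_real_vector by blast
    have "A x = complex_of_real r *s (\<beta> *s vcnj (A b))"
      unfolding b(3) complex_linear_smult[OF A] \<beta>(2)[symmetric] ..
    also have "\<dots> = \<beta> *s vcnj (A x)"
      unfolding b(3) complex_linear_smult[OF A] vcnj_smult by (simp add: mult.commute)
    finally show ?thesis using \<beta>(1) by blast
  qed
  show "\<sigma> z = A z" if "norm z < 1/3"
  proof (rule linear_near_0_of_linear_on_real_lines[OF hol A _ that])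
    fix x :: "complex^'m" assume x: "vcnj x = x" "norm x < 1"
    show "\<sigma> x = A x"
    proof (cases "x = 0")
      case True
      then show ?thesis using \<sigma>0 complex_linear_smult[OF A, of 0 0] by simp
    next
      case False
      then obtain b r where b: "vcnj b = b" "norm b = sqrt 2" "r > 0" "norm x = r * sqrt 2"
          "x = complex_of_real r *s b"
        using scale[OF x(1)] by blast
      have "r * 1 \<le> r * sqrt 2" using b(3) by (intro mult_left_mono) auto
      then have "r < 1" using x(2) b(4) by linarith
      then show ?thesis unfolding b(5) complex_linear_smult[OF A] using b(3) by (intro lin[OF b(1,2)]) simp
    qed
  qed
qed

section \<open>Criterion for minimality\<close>

lemma complex_linear_compose: "complex_linear L \<Longrightarrow> complex_linear M \<Longrightarrow> complex_linear (L \<circ> M)"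
  by (auto simp: complex_linear_def linear_compose)

lemma cholo_compose:
  assumes "cholo U F" "cholo V G" "\<And>z. z \<in> U \<Longrightarrow> F z \<in> V"
  shows "cholo U (G \<circ> F)"
  unfolding cholo_def
proof
  fix z assume z: "z \<in> U"
  obtain L where L: "(F has_derivative L) (at z)" "complex_linear L"
    using assms(1) z by (rule cholo_derivative)
  obtain M where M: "(G has_derivative M) (at (F z))" "complex_linear M"
    using assms(2) assms(3)[OF z] by (rule cholo_derivative)
  show "\<exists>L. (G \<circ> F has_derivative L) (at z) \<and> (\<forall>c x. L (c *s x) = c *s L x)"
    using diff_chain_at[OF L(1) M(1)] complex_linear_compose[OF M(2) L(2)]
    unfolding complex_linear_def by blast
qed

text \<open>An involution fixing all values of \<open>F\<close> agrees with its derivative only near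
  0, so \<open>indep\<close> and \<open>nondeg\<close> are stated on arbitrarily small balls.
  \<open>nondeg\<close> provides the non-isotropic value that excludes a phase, and
  \<open>indep\<close> rules out the (-1)-eigenvector inherited from a reflection.\<close>

lemma minimum_mapI:
  fixes F :: "complex^'n \<Rightarrow> complex^('m::{finite,linorder})"
  assumes hol: "cholo cball_unit F" and F0: "F 0 = 0"
    and indep: "\<And>r e. e > 0 \<Longrightarrow> (\<And>z. norm z < e \<Longrightarrow> (\<Sum>i\<in>UNIV. of_real (r i) * F z $ i) = 0)
      \<Longrightarrow> (\<And>i. r i = (0::real))"
    and nondeg: "\<And>e. e > 0 \<Longrightarrow> \<exists>z. norm z < e \<and> (\<Sum>i\<in>UNIV. (F z $ i)\<^sup>2) \<noteq> 0"
  shows "minimum_map F"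
  unfolding minimum_map_def
proof (rule notI, elim exE conjE)
  fix H :: "complex^'n \<Rightarrow> complex^('m::{finite,linorder})"
  assume H: "cholo cball_unit H" "H ` cball_unit \<subseteq> DIV"
    and Hmax: "\<forall>z\<in>cball_unit. H z $ Max UNIV = 0" and "equivalent_maps F H"
  then obtain \<psi> \<phi> where \<psi>: "biholo_aut cball_unit \<psi>" and \<phi>: "biholo_aut DIV \<phi>"
    and eq: "\<And>z. z \<in> cball_unit \<Longrightarrow> F z = \<phi> (H (\<psi> z))"
    unfolding equivalent_maps_def by blast
  define \<theta> where "\<theta> = inv_into DIV \<phi>"
  have bij: "bij_betw \<phi> DIV DIV" and hol\<phi>: "cholo DIV \<phi>" and hol\<theta>: "cholo DIV \<theta>"
    using \<phi> by (auto simp: biholo_aut_def \<theta>_def)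
  have \<theta>in: "\<theta> Z \<in> DIV" and \<phi>in: "\<phi> Z \<in> DIV" and \<phi>\<theta>: "\<phi> (\<theta> Z) = Z" and \<theta>\<phi>: "\<theta> (\<phi> Z) = Z"
    if "Z \<in> DIV" for Z
    using bij that unfolding \<theta>_def
    by (auto simp: bij_betw_def inv_into_into f_inv_into_f inv_into_f_f)
  \<comment> \<open>The reflection whose mirror contains the image of \<open>H\<close>.\<close>
  define s :: "complex^('m::{finite,linorder}) \<Rightarrow> complex^('m::{finite,linorder})" where "s Z = (\<chi> i. if i = Max UNIV then - Z $ i else Z $ i)" for Z
  have s_nth: "s Z $ i = (if i = Max UNIV then - Z $ i else Z $ i)" for Z i by (simp add: s_def)
  have cl_s: "complex_linear s"
    unfolding complex_linear_def by (intro conjI allI linearI) (auto simp: vec_eq_iff s_nth)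
  have ss: "s (s Z) = Z" for Z by (simp add: vec_eq_iff s_nth)
  have norm_s: "norm (s Z) = norm Z" for Z
    unfolding norm_vec_def by (rule L2_set_cong) (auto simp: s_nth)
  have sq_s: "(s Z $ i)\<^sup>2 = (Z $ i)\<^sup>2" for Z i by (simp add: s_nth)
  have s_in: "s Z \<in> DIV" if "Z \<in> DIV" for Z
    using that unfolding DIV_def norm_power2_vec[symmetric] by (simp add: norm_s sq_s)
  have ds: "(s has_derivative s) (at Z)" for Z
    using cl_s by (intro linear_imp_has_derivative) (simp add: complex_linear_def)
  have hol_s: "cholo DIV s"
    using ds cl_s unfolding cholo_def complex_linear_def by blast
  have \<psi>in: "\<psi> z \<in> cball_unit" if "z \<in> cball_unit" for z
    using \<psi> that by (auto simp: biholo_aut_def bij_betw_def)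
  have sH: "s (H (\<psi> z)) = H (\<psi> z)" if "z \<in> cball_unit" for z
    using Hmax \<psi>in[OF that] by (auto simp: vec_eq_iff s_nth)
  define \<sigma> where "\<sigma> = \<phi> \<circ> (s \<circ> \<theta>)"
  have \<sigma>F: "\<sigma> (F z) = F z" if z: "z \<in> cball_unit" for z
  proof -
    have "H (\<psi> z) \<in> DIV" using H(2) \<psi>in[OF z] by blast
    then show ?thesis using eq[OF z] sH[OF z] by (simp add: \<sigma>_def \<theta>\<phi>)
  qed
  have z0: "(0::complex^'n) \<in> cball_unit" by (simp add: cball_unit_def)
  have D0: "(0::complex^('m::{finite,linorder})) \<in> DIV" by (simp add: ball_subset_DIV)
  have \<sigma>0: "\<sigma> 0 = 0" using \<sigma>F[OF z0] F0 by simp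
  have hol\<sigma>: "cholo DIV \<sigma>" unfolding \<sigma>_def
    by (intro cholo_compose[where V = DIV] hol\<phi> hol_s hol\<theta>) (auto intro: \<theta>in s_in)
  have \<sigma>in: "\<sigma> Z \<in> DIV" if "Z \<in> DIV" for Z using that by (simp add: \<sigma>_def \<theta>in \<phi>in s_in)
  \<comment> \<open>The preimage of 0 lies on the mirror, so the chain rule for
    \<open>\<sigma>\<close> at 0 uses the derivatives of \<open>\<phi>\<close> and
    \<open>\<theta>\<close> at matching points, and these are mutually inverse.\<close>
  define p where "p = \<theta> 0"
  have pH: "p = H (\<psi> 0)"
    using eq[OF z0] F0 \<theta>\<phi>[of "H (\<psi> 0)"] H(2) \<psi>in[OF z0] by (auto simp: p_def)
  have sp: "s p = p" using sH[OF z0] pH by simp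
  have pD: "p \<in> DIV" by (simp add: p_def \<theta>in D0)
  obtain P where P: "(\<phi> has_derivative P) (at p)" "complex_linear P"
    using hol\<phi> pD by (rule cholo_derivative)
  obtain Q where Q: "(\<theta> has_derivative Q) (at 0)" "complex_linear Q"
    using hol\<theta> D0 by (rule cholo_derivative)
  have QP: "Q (P u) = u" for u
  proof -
    have "\<phi> p = 0" by (simp add: p_def \<phi>\<theta> D0)
    then have "((\<theta> \<circ> \<phi>) has_derivative (Q \<circ> P)) (at p)"
      using diff_chain_at[OF P(1)] Q(1) by simp
    then have "((\<lambda>Z. Z) has_derivative (Q \<circ> P)) (at p)"
      by (rule has_derivative_transform_within_open[OF _ open_DIV pD]) (simp add: \<theta>\<phi>)
    then have "Q \<circ> P = (\<lambda>u. u)" using has_derivative_ident has_derivative_unique by blast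
    then show ?thesis by (simp add: fun_eq_iff)
  qed
  have PQ: "P (Q u) = u" for u
  proof -
    have "((\<phi> \<circ> \<theta>) has_derivative (P \<circ> Q)) (at 0)"
      using diff_chain_at[OF Q(1)] P(1) by (simp add: p_def)
    then have "((\<lambda>Z. Z) has_derivative (P \<circ> Q)) (at 0)"
      by (rule has_derivative_transform_within_open[OF _ open_DIV D0]) (simp add: \<phi>\<theta>)
    then have "P \<circ> Q = (\<lambda>u. u)" using has_derivative_ident has_derivative_unique by blast
    then show ?thesis by (simp add: fun_eq_iff)
  qed
  define A where "A = P \<circ> (s \<circ> Q)"
  have A: "complex_linear A" unfolding A_def by (intro complex_linear_compose P Q cl_s)
  have dA: "(\<sigma> has_derivative A) (at 0)"
    unfolding \<sigma>_def A_def
    by (intro diff_chain_at Q ds) (use P sp in \<open>simp add: p_def\<close>)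
  have AA: "A (A u) = u" for u by (simp add: A_def QP ss PQ)
  note inv = DIV_involution[OF hol\<sigma> \<sigma>in \<sigma>0 dA A AA]
  have "continuous (at 0) F"
    using hol z0 cholo_derivative has_derivative_continuous by metis
  then obtain e1 where e1: "e1 > 0" "\<And>z. norm z < e1 \<Longrightarrow> norm (F z) < 1/3"
    using F0 unfolding continuous_at_eps_delta
    by (metis (no_types, lifting) diff_zero dist_norm zero_less_divide_1_iff zero_less_numeral)
  \<comment> \<open>Small enough that \<open>z\<close> lies in the unit ball and \<open>F z\<close>
    in the region where \<open>\<sigma>\<close> is linear.\<close>
  define e where "e = min e1 1"
  have e: "e > 0" using e1 by (simp add: e_def)
  have AF: "A (F z) = F z" if "norm z < e" for z
  proof -
    have "(norm z)\<^sup>2 < 1" using that by (simp add: e_def power_less_one_iff)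
    then have "z \<in> cball_unit" by (simp add: cball_unit_def norm_power2_vec)
    then show ?thesis using inv(3)[of "F z"] e1(2)[of z] \<sigma>F that by (simp add: e_def)
  qed
  obtain z1 where z1: "norm z1 < e" "(\<Sum>i\<in>UNIV. (F z1 $ i)\<^sup>2) \<noteq> 0" using nondeg[OF e] by blast
  have z1': "herm (F z1) (vcnj (F z1)) \<noteq> 0" using z1(2) by (simp add: herm_def vcnj_def power2_eq_square)
  have AcF: "A (vcnj (F z)) = vcnj (F z)" if "norm z < e" for z
    by (rule fixes_conjugate_of_fixed[OF A AA inv(1,2) AF[OF z1(1)] z1' AF[OF that]])
  \<comment> \<open>The transported normal of the mirror: \<open>A\<close> sends it to its
    negative.\<close>
  define w where "w = P (axis (Max UNIV) 1)"
  have "s (axis (Max UNIV) 1) = (-1) *s axis (Max UNIV) 1"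
    by (auto simp: vec_eq_iff s_nth axis_def)
  then have Aw: "A w = (-1) *s w"
    using complex_linear_smult[OF P(2), of "-1" "axis (Max UNIV) 1"] by (simp add: A_def w_def QP)
  \<comment> \<open>Eigenvectors of a self-adjoint map for the eigenvalues -1 and 1 are
    orthogonal.\<close>
  have orth: "herm w v = 0" if "A v = v" for v
    using inv(1)[of w v] unfolding Aw that herm_smult_left by simp
  have sums: "(\<Sum>i\<in>UNIV. w $ i * F z $ i) = 0" "(\<Sum>i\<in>UNIV. cnj (w $ i) * F z $ i) = 0"
    if "norm z < e" for z
  proof -
    show "(\<Sum>i\<in>UNIV. w $ i * F z $ i) = 0"
      using orth[OF AcF[OF that]] by (simp add: herm_def vcnj_def)
    show "(\<Sum>i\<in>UNIV. cnj (w $ i) * F z $ i) = 0"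
      using arg_cong[OF orth[OF AF[OF that]], of cnj] by (simp add: herm_def)
  qed
  \<comment> \<open>Adding and subtracting the two relations turns them into relations with real
    coefficients.\<close>
  have "Re (w $ i) = 0" for i
  proof (rule indep[OF e])
    fix z :: "complex^'n" assume "norm z < e"
    from sums[OF this] have "(\<Sum>i\<in>UNIV. (w $ i + cnj (w $ i)) * F z $ i) = 0"
      by (simp add: distrib_right sum.distrib)
    then have "2 * (\<Sum>i\<in>UNIV. of_real (Re (w $ i)) * F z $ i) = 0"
      by (simp add: complex_add_cnj sum_distrib_left mult.assoc)
    then show "(\<Sum>i\<in>UNIV. of_real (Re (w $ i)) * F z $ i) = 0" by simp
  qed
  moreover have "Im (w $ i) = 0" for i
  proof (rule indep[OF e])
    fix z :: "complex^'n" assume "norm z < e"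
    from sums[OF this] have "(\<Sum>i\<in>UNIV. (w $ i - cnj (w $ i)) * F z $ i) = 0"
      by (simp add: left_diff_distrib sum_subtractf)
    then have "(2 * \<i>) * (\<Sum>i\<in>UNIV. of_real (Im (w $ i)) * F z $ i) = 0"
      by (simp add: complex_diff_cnj sum_distrib_left mult_ac)
    then show "(\<Sum>i\<in>UNIV. of_real (Im (w $ i)) * F z $ i) = 0" by simp
  qed
  ultimately have "w = 0" by (simp add: vec_eq_iff complex_eq_iff)
  then have "Q w = 0" using complex_linear_smult[OF Q(2), of 0 0] by simp
  then have "axis (Max UNIV) 1 = (0 :: complex^('m::{finite,linorder}))" by (simp add: w_def QP)
  then show False by simp
qed

section \<open>Proper monomial maps of balls\<close>

definition scalar_cholo :: "(complex^'n) set \<Rightarrow> (complex^'n \<Rightarrow> complex) \<Rightarrow> bool" where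
  "scalar_cholo U f \<longleftrightarrow>
    (\<forall>z\<in>U. \<exists>L. (f has_derivative L) (at z) \<and> (\<forall>c x. L (c *s x) = c * L x))"

lemma cholo_componentwise:
  assumes "\<And>i. scalar_cholo U (\<lambda>z. F z $ i)"
  shows "cholo U F"
  unfolding cholo_def
proof
  fix z assume "z \<in> U"
  then have "\<forall>i. \<exists>L. ((\<lambda>z. F z $ i) has_derivative L) (at z) \<and> (\<forall>c x. L (c *s x) = c * L x)"
    using assms unfolding scalar_cholo_def by blast
  from choice[OF this] obtain L where
    L: "\<And>i. ((\<lambda>z. F z $ i) has_derivative L i) (at z)" "\<And>i c x. L i (c *s x) = c * L i x"
    by blast
  have "((\<lambda>z. \<Sum>i\<in>UNIV. F z $ i *s axis i 1) has_derivative
      (\<lambda>x. \<Sum>i\<in>UNIV. L i x *s axis i 1)) (at z)"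
    by (intro has_derivative_sum bounded_linear.has_derivative[OF bounded_linear_smult_right] L)
  then have "(F has_derivative (\<lambda>x. \<Sum>i\<in>UNIV. L i x *s axis i 1)) (at z)"
    by (simp add: basis_expansion)
  moreover have "(\<Sum>i\<in>UNIV. L i (c *s x) *s axis i 1) = c *s (\<Sum>i\<in>UNIV. L i x *s axis i 1)" for c x
    unfolding L(2) by (simp add: vec_eq_iff sum_component sum_distrib_left mult.assoc)
  ultimately show "\<exists>L. (F has_derivative L) (at z) \<and> (\<forall>c x. L (c *s x) = c *s L x)" by blast
qed

lemma scalar_cholo_const: "scalar_cholo U (\<lambda>z. c)"
  unfolding scalar_cholo_def by (intro ballI exI[of _ "\<lambda>x. 0"]) auto

lemma scalar_cholo_nth: "scalar_cholo U (\<lambda>z. z $ i)"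
  unfolding scalar_cholo_def
  by (intro ballI exI[of _ "\<lambda>x. x $ i"])
    (auto intro: bounded_linear_imp_has_derivative[OF bounded_linear_vec_nth])

lemma scalar_cholo_add:
  assumes "scalar_cholo U f" "scalar_cholo U g"
  shows "scalar_cholo U (\<lambda>z. f z + g z)"
  unfolding scalar_cholo_def
proof
  fix z assume z: "z \<in> U"
  obtain L M where "(f has_derivative L) (at z)" "\<And>c x. L (c *s x) = c * L x"
      "(g has_derivative M) (at z)" "\<And>c x. M (c *s x) = c * M x"
    using assms z unfolding scalar_cholo_def by metis
  then show "\<exists>L. ((\<lambda>z. f z + g z) has_derivative L) (at z) \<and> (\<forall>c x. L (c *s x) = c * L x)"
    by (intro exI[of _ "\<lambda>x. L x + M x"]) (auto intro: has_derivative_add simp: distrib_left)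
qed

lemma scalar_cholo_mult:
  assumes "scalar_cholo U f" "scalar_cholo U g"
  shows "scalar_cholo U (\<lambda>z. f z * g z)"
  unfolding scalar_cholo_def
proof
  fix z assume z: "z \<in> U"
  obtain L M where LM: "(f has_derivative L) (at z)" "\<And>c x. L (c *s x) = c * L x"
      "(g has_derivative M) (at z)" "\<And>c x. M (c *s x) = c * M x"
    using assms z unfolding scalar_cholo_def by metis
  show "\<exists>L. ((\<lambda>z. f z * g z) has_derivative L) (at z) \<and> (\<forall>c x. L (c *s x) = c * L x)"
  proof (intro exI conjI allI)
    show "((\<lambda>z. f z * g z) has_derivative (\<lambda>x. f z * M x + L x * g z)) (at z)"
      by (rule has_derivative_mult[OF LM(1,3)])
  qed (simp add: LM(2,4) algebra_simps)
qed

lemma scalar_cholo_power: "scalar_cholo U f \<Longrightarrow> scalar_cholo U (\<lambda>z. f z ^ k)"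
  by (induction k) (auto intro: scalar_cholo_const scalar_cholo_mult)

lemma scalar_cholo_sum: "(\<And>q. q \<in> S \<Longrightarrow> scalar_cholo U (f q)) \<Longrightarrow> scalar_cholo U (\<lambda>z. \<Sum>q\<in>S. f q z)"
  by (induction S rule: infinite_finite_induct) (auto intro: scalar_cholo_const scalar_cholo_add)

lemma scalar_cholo_csqrt:
  assumes "scalar_cholo U f" "\<And>z. z \<in> U \<Longrightarrow> f z \<notin> \<real>\<^sub>\<le>\<^sub>0"
  shows "scalar_cholo U (\<lambda>z. csqrt (f z))"
  unfolding scalar_cholo_def
proof
  fix z assume z: "z \<in> U"
  obtain L where L: "(f has_derivative L) (at z)" "\<And>c x. L (c *s x) = c * L x"
    using assms(1) z unfolding scalar_cholo_def by metis
  have "((\<lambda>z. csqrt (f z)) has_derivative (\<lambda>x. inverse (2 * csqrt (f z)) * L x)) (at z)"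
    using has_derivative_compose[OF L(1)]
      has_field_derivative_csqrt[OF assms(2)[OF z], unfolded has_field_derivative_def] by blast
  then show "\<exists>L. ((\<lambda>z. csqrt (f z)) has_derivative L) (at z) \<and> (\<forall>c x. L (c *s x) = c * L x)"
    by (intro exI[of _ "\<lambda>x. inverse (2 * csqrt (f z)) * L x"]) (auto simp: L(2))
qed

text \<open>The components of a proper monomial map of balls: start from the identity and repeatedly
  replace half of the component with the highest power of the variable of index a by its tensor
  product with z.\<close>
definition tensor_coeff :: "nat \<Rightarrow> 'n \<Rightarrow> nat \<times> 'n \<Rightarrow> real" where
  "tensor_coeff d a q = sqrt ((1/2) ^ fst q * (if snd q = a \<and> fst q < d then 1/2 else 1))"

definition tensor_mono :: "nat \<Rightarrow> 'n \<Rightarrow> nat \<times> 'n \<Rightarrow> complex^'n \<Rightarrow> complex" where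
  "tensor_mono d a q z = of_real (tensor_coeff d a q) * (z $ snd q * (z $ a) ^ fst q)"

lemma tensor_coeff_power2:
  "(tensor_coeff d a q)\<^sup>2 = (1/2) ^ fst q * (if snd q = a \<and> fst q < d then 1/2 else 1)"
  unfolding tensor_coeff_def by (intro real_sqrt_pow2 mult_nonneg_nonneg) auto

lemma tensor_coeff_neq_0: "tensor_coeff d a q \<noteq> 0"
  by (simp add: tensor_coeff_def)

text \<open>Put x = |z_a|^2 / 2. Level j contributes |z|^2 x^j, less x^(j+1) for its halved
  component when j < d. The subtracted terms add up to the geometric sum without its leading
  1.\<close>

lemma sum_norm_tensor_mono:
  fixes z :: "complex^'n"
  shows "(\<Sum>q\<in>{..d}\<times>UNIV. (cmod (tensor_mono d a q z))\<^sup>2) =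
    1 - (1 - (norm z)\<^sup>2) * (\<Sum>j\<le>d. ((cmod (z $ a))\<^sup>2 / 2) ^ j)"
proof -
  define t where "t = (cmod (z $ a))\<^sup>2"
  define x where "x = t / 2"
  have tm: "(cmod (tensor_mono d a (j, i) z))\<^sup>2 =
      x ^ j * ((cmod (z $ i))\<^sup>2 - (if i = a then if j < d then x else 0 else 0))" for j i
  proof -
    have "(cmod (tensor_mono d a (j, i) z))\<^sup>2 =
        (tensor_coeff d a (j, i))\<^sup>2 * ((cmod (z $ i))\<^sup>2 * t ^ j)"
      by (simp add: tensor_mono_def norm_mult norm_power power_mult_distrib t_def power_mult
          mult.commute flip: power_mult)
    then show ?thesis
      by (auto simp: tensor_coeff_power2 x_def power_divide field_simps t_def)
  qed
  have inner: "(\<Sum>i\<in>UNIV. (cmod (tensor_mono d a (j, i) z))\<^sup>2) =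
      (norm z)\<^sup>2 * x ^ j - (if j < d then x ^ Suc j else 0)" for j
    unfolding tm sum_distrib_left[symmetric] sum_subtractf norm_power2_vec
    by (simp add: algebra_simps)
  have "(\<Sum>j\<le>d. if j < d then x ^ Suc j else 0) = (\<Sum>j<d. x ^ Suc j)"
    by (simp flip: lessThan_Suc_atMost)
  moreover have "(\<Sum>j\<le>d. x ^ j) = 1 + (\<Sum>j<d. x ^ Suc j)"
    unfolding lessThan_Suc_atMost[symmetric] sum.lessThan_Suc_shift by simp
  ultimately have "(\<Sum>j\<le>d. \<Sum>i\<in>UNIV. (cmod (tensor_mono d a (j, i) z))\<^sup>2) =
      1 - (1 - (norm z)\<^sup>2) * (\<Sum>j\<le>d. x ^ j)"
    unfolding inner sum_subtractf sum_distrib_left[symmetric] by (simp add: algebra_simps)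
  then show ?thesis unfolding sum.cartesian_product by (simp add: x_def t_def case_prod_unfold)
qed

lemma sum_norm_tensor_mono_less:
  assumes "norm (z::complex^'n) < 1"
  shows "(\<Sum>q\<in>{..d}\<times>UNIV. (cmod (tensor_mono d a q z))\<^sup>2) < 1"
proof -
  have "(\<Sum>j\<le>d. ((cmod (z $ a))\<^sup>2 / 2) ^ j) > 0"
    by (rule sum_pos2[of _ 0]) auto
  moreover have "1 - (norm z)\<^sup>2 > 0" using assms by (simp add: power_less_one_iff)
  ultimately show ?thesis unfolding sum_norm_tensor_mono by simp
qed

text \<open>The root of h^2 - 2 h + s = 0 that vanishes at s = 0; the principal branch is
  holomorphic in s on the unit disc.\<close>

definition quadric_root :: "complex \<Rightarrow> complex" where
  "quadric_root s = 1 - csqrt (1 - s)"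

lemma quadric_root_eq: "(quadric_root s)\<^sup>2 + s = 2 * quadric_root s"
proof -
  have "(1 - quadric_root s)\<^sup>2 = 1 - s" by (simp add: quadric_root_def)
  then show ?thesis by (simp add: power2_eq_square algebra_simps)
qed

text \<open>The product of the root with 1 + sqrt (1 - s) is s, and that factor has real part at
  least 1.\<close>

lemma norm_quadric_root_le: "cmod (quadric_root s) \<le> cmod s"
proof -
  have "quadric_root s * (1 + csqrt (1 - s)) = s"
    using power2_csqrt[of "1 - s"] unfolding quadric_root_def
    by (simp add: power2_eq_square algebra_simps del: power2_csqrt)
  then have "cmod s = cmod (quadric_root s) * cmod (1 + csqrt (1 - s))"
    by (metis norm_mult)
  moreover have "1 \<le> cmod (1 + csqrt (1 - s))"
    using complex_Re_le_cmod[of "1 + csqrt (1 - s)"] Re_csqrt[of "1 - s"]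
    unfolding plus_complex.sel one_complex.sel by linarith
  ultimately show ?thesis using mult_left_mono[of 1 "cmod (1 + csqrt (1 - s))" "cmod (quadric_root s)"] by simp
qed

lemma quadric_root_of_real:
  "s \<le> 1 \<Longrightarrow> quadric_root (of_real s) = of_real (1 - sqrt (1 - s))"
  using of_real_sqrt[of "1 - s"] by (simp add: quadric_root_def)

section \<open>Linear independence of the monomials and the quadric root\<close>

lemma tensor_mono_axis:
  "tensor_mono d a q (of_real t *s axis a 1) =
    (if snd q = a then of_real (tensor_coeff d a q * t ^ Suc (fst q)) else 0)"
  by (simp add: tensor_mono_def axis_def)

lemma poly_vanishing_near_0:
  fixes p :: "real poly"
  assumes "e > 0" "\<And>t. 0 < t \<Longrightarrow> t < e \<Longrightarrow> poly p t = 0"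
  shows "p = 0"
proof (rule ccontr)
  assume "p \<noteq> 0"
  then have "finite {t. poly p t = 0}" by (rule poly_roots_finite)
  moreover have "{0<..<e} \<subseteq> {t. poly p t = 0}" using assms by auto
  ultimately have "finite {0<..<e}" by (rule rev_finite_subset)
  then show False using infinite_Ioo[OF assms(1)] by blast
qed

lemma complex_polynomial_vanishing_near_0:
  fixes c :: "nat \<Rightarrow> complex"
  assumes "e > 0" "\<And>t. 0 < t \<Longrightarrow> t < e \<Longrightarrow> (\<Sum>j\<le>d. c j * of_real t ^ j) = 0" "j \<le> d"
  shows "c j = 0"
proof (rule ccontr)
  assume "c j \<noteq> 0"
  then have "finite {x. (\<Sum>j\<le>d. c j * x ^ j) = 0}" using assms(3) polyfun_finite_roots by blast
  moreover have "complex_of_real ` {0<..<e} \<subseteq> {x. (\<Sum>j\<le>d. c j * x ^ j) = 0}" using assms(2) by auto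
  ultimately have "finite (complex_of_real ` {0<..<e})" by (rule rev_finite_subset)
  then have "finite {0<..<e}" by (rule finite_imageD) (simp add: inj_on_def)
  then show False using infinite_Ioo[OF assms(1)] by blast
qed

text \<open>On the axis of \<open>a\<close> only the indices (j, a) survive, with distinct powers of
  t, so their coefficients vanish. Once these are gone, the line through the sum of the axes
  \<open>a\<close> and i isolates the indices (j, i) in the same way.\<close>

lemma tensor_mono_independent:
  fixes a :: "'n::finite" and \<alpha> :: "nat \<times> 'n::finite \<Rightarrow> complex"
  assumes e: "e > 0" and q: "q \<in> {..d} \<times> UNIV"
    and zero: "\<And>z. norm z < e \<Longrightarrow> (\<Sum>q\<in>{..d}\<times>UNIV. \<alpha> q * tensor_mono d a q z) = 0"
  shows "\<alpha> q = 0"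
proof -
  have zero': "(\<Sum>j\<le>d. \<Sum>i\<in>UNIV. \<alpha> (j, i) * tensor_mono d a (j, i) z) = 0" if "norm z < e" for z
    using zero[OF that] unfolding sum.cartesian_product by (simp add: case_prod_unfold)
  have pivot: "\<alpha> (j, a) = 0" if j: "j \<le> d" for j
  proof -
    have "\<alpha> (j, a) * of_real (tensor_coeff d a (j, a)) = 0"
    proof (rule complex_polynomial_vanishing_near_0[OF e _ j])
      fix t :: real assume t: "0 < t" "t < e"
      let ?z = "complex_of_real t *s axis a 1"
      have eq: "(\<Sum>i\<in>UNIV. \<alpha> (j, i) * tensor_mono d a (j, i) ?z) =
          of_real t * (\<alpha> (j, a) * of_real (tensor_coeff d a (j, a)) * of_real t ^ j)" for j
      proof -
        have "(\<Sum>i\<in>UNIV. \<alpha> (j, i) * tensor_mono d a (j, i) ?z) =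
            (\<Sum>i\<in>UNIV. if i = a then \<alpha> (j, i) * of_real (tensor_coeff d a (j, i) * t ^ Suc j) else 0)"
          unfolding tensor_mono_axis by (rule sum.cong) auto
        then show ?thesis by (simp add: mult_ac)
      qed
      have "norm ?z < e" using t by (simp add: norm_smult_vec)
      from zero'[OF this] have "of_real t *
          (\<Sum>j\<le>d. \<alpha> (j, a) * of_real (tensor_coeff d a (j, a)) * of_real t ^ j) = 0"
        unfolding eq sum_distrib_left .
      then show "(\<Sum>j\<le>d. \<alpha> (j, a) * of_real (tensor_coeff d a (j, a)) * of_real t ^ j) = 0"
        using t by simp
    qed
    then show ?thesis by (simp add: tensor_coeff_neq_0)
  qed
  have "\<alpha> (j, i) = 0" if j: "j \<le> d" and i: "i \<noteq> a" for j i
  proof -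
    have "\<alpha> (j, i) * of_real (tensor_coeff d a (j, i)) = 0"
    \<comment> \<open>Half the radius, since the sum of two basis vectors has norm at most
      2.\<close>
    proof (rule complex_polynomial_vanishing_near_0[where e = "e/2" and d = d, OF _ _ j])
      show "e/2 > 0" using e by simp
      fix t :: real assume t: "0 < t" "t < e/2"
      let ?z = "complex_of_real t *s (axis a 1 + axis i 1)"
      have eq: "(\<Sum>k\<in>UNIV. \<alpha> (j, k) * tensor_mono d a (j, k) ?z) =
          of_real t * (\<alpha> (j, i) * of_real (tensor_coeff d a (j, i)) * of_real t ^ j)"
        if "j \<le> d" for j
      proof -
        have "\<alpha> (j, k) * tensor_mono d a (j, k) ?z =
            (if k = i then of_real t * (\<alpha> (j, i) * of_real (tensor_coeff d a (j, i)) * of_real t ^ j) else 0)" for k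
          using i pivot[OF that] by (auto simp: tensor_mono_def axis_def)
        then show ?thesis by simp
      qed
      have nz: "norm ?z < e"
      proof -
        have "norm (axis a 1 + axis i (1::complex)) \<le> 2"
          using norm_triangle_ineq[of "axis a 1" "axis i (1::complex)"] by simp
        then have "t * norm (axis a 1 + axis i (1::complex)) \<le> t * 2"
          using t by (intro mult_left_mono) auto
        moreover have "norm ?z = t * norm (axis a 1 + axis i (1::complex))"
          unfolding norm_smult_vec using t by simp
        ultimately show ?thesis using t by linarith
      qed
      have "of_real t *
          (\<Sum>j\<le>d. \<alpha> (j, i) * of_real (tensor_coeff d a (j, i)) * of_real t ^ j) =
          (\<Sum>j\<le>d. \<Sum>k\<in>UNIV. \<alpha> (j, k) * tensor_mono d a (j, k) ?z)"
        unfolding sum_distrib_left by (rule sum.cong) (simp_all only: eq atMost_iff)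
      also have "\<dots> = 0" by (rule zero'[OF nz])
      finally have "of_real t *
          (\<Sum>j\<le>d. \<alpha> (j, i) * of_real (tensor_coeff d a (j, i)) * of_real t ^ j) = 0" .
      then show "(\<Sum>j\<le>d. \<alpha> (j, i) * of_real (tensor_coeff d a (j, i)) * of_real t ^ j) = 0"
        using t by simp
    qed
    then show ?thesis by (simp add: tensor_coeff_neq_0)
  qed
  then show ?thesis using pivot q by (metis SigmaE atMost_iff)
qed

text \<open>If r were nonzero, then on real multiples of the axis of \<open>a\<close> the square
  root of 1 - s(t) would be a polynomial p near 0. Then p^2 = 1 - s identically, but s exceeds 1 for
  large real t, where p^2 is still nonnegative.\<close>

lemma quadric_root_tensor_mono_independent:
  fixes a :: "'n::finite" and \<alpha> :: "nat \<times> 'n::finite \<Rightarrow> complex" and r :: real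
  assumes e: "e > 0" and S: "S \<subseteq> {..d} \<times> UNIV" "(0, a) \<in> S"
    and zero: "\<And>z. norm z < e \<Longrightarrow>
      of_real r * quadric_root (\<Sum>q\<in>S. (tensor_mono d a q z)\<^sup>2)
        + (\<Sum>q\<in>{..d}\<times>UNIV. \<alpha> q * tensor_mono d a q z) = 0"
  shows "r = 0" and "q \<in> {..d} \<times> UNIV \<Longrightarrow> \<alpha> q = 0"
proof -
  have fin: "finite S" using S(1) by (rule finite_subset) simp
  show r0: "r = 0"
  proof (rule ccontr)
    assume r: "r \<noteq> 0"
    define s where "s t = (\<Sum>q\<in>S. if snd q = a then (tensor_coeff d a q)\<^sup>2 * t ^ (2 * Suc (fst q)) else 0)" for t :: real
    have s: "(\<Sum>q\<in>S. (tensor_mono d a q (of_real t *s axis a 1))\<^sup>2) = of_real (s t)" for t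
      unfolding s_def of_real_sum
    proof (rule sum.cong)
      fix q assume "q \<in> S"
      have "(tensor_coeff d a q * t ^ Suc (fst q))\<^sup>2 = (tensor_coeff d a q)\<^sup>2 * t ^ (2 * Suc (fst q))"
        by (simp only: power_mult_distrib power_mult[symmetric] mult.commute)
      then show "(tensor_mono d a q (of_real t *s axis a 1))\<^sup>2 = of_real
          (if snd q = a then (tensor_coeff d a q)\<^sup>2 * t ^ (2 * Suc (fst q)) else 0)"
        unfolding tensor_mono_axis by (simp only: of_real_power[symmetric] split: if_split) simp
    qed simp
    \<comment> \<open>Coefficients of the real part of the relation after division by
      \<open>r\<close>; the real part suffices because t, s(t) and the root are real.\<close>
    define x where "x j = Re (\<alpha> (j, a)) * tensor_coeff d a (j, a) / r" for j
    define p where "p = 1 + (\<Sum>j\<le>d. monom (x j) (Suc j))"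
    define ps where "ps = (\<Sum>q\<in>S. if snd q = a then monom ((tensor_coeff d a q)\<^sup>2) (2 * Suc (fst q)) else 0)"
    have ps: "poly ps t = s t" for t
      unfolding ps_def s_def poly_sum by (rule sum.cong) (auto simp: poly_monom)
    have "p\<^sup>2 - (1 - ps) = 0"
    proof (rule poly_vanishing_near_0[of "min e 1"])
      show "min e 1 > 0" using e by simp
      fix t :: real assume t: "0 < t" "t < min e 1"
      let ?z = "complex_of_real t *s axis a 1"
      have nz: "norm ?z = t" using t by (simp add: norm_smult_vec)
      have "cmod (of_real (s t)) \<le> (\<Sum>q\<in>S. (cmod (tensor_mono d a q ?z))\<^sup>2)"
        unfolding s[symmetric] by (rule order_trans[OF norm_sum]) (simp add: norm_power)
      also have "\<dots> \<le> (\<Sum>q\<in>{..d}\<times>UNIV. (cmod (tensor_mono d a q ?z))\<^sup>2)"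
        using S by (intro sum_mono2) auto
      also have "\<dots> < 1" using nz t by (intro sum_norm_tensor_mono_less) simp
      finally have s1: "s t \<le> 1" by simp
      have "Re (\<Sum>q\<in>{..d}\<times>UNIV. \<alpha> q * tensor_mono d a q ?z) = r * (\<Sum>j\<le>d. x j * t ^ Suc j)"
      proof -
        have "Re (\<Sum>q\<in>{..d}\<times>UNIV. \<alpha> q * tensor_mono d a q ?z) =
            (\<Sum>j\<le>d. \<Sum>i\<in>UNIV. if i = a then r * (x j * t ^ Suc j) else 0)"
          unfolding sum.cartesian_product Re_sum tensor_mono_axis
          using r by (intro sum.cong) (auto simp: x_def)
        then show ?thesis by (simp add: sum_distrib_left)
      qed
      moreover have "Re (of_real r * quadric_root (of_real (s t))) = r * (1 - sqrt (1 - s t))"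
        unfolding quadric_root_of_real[OF s1] by (simp only: Re_complex_of_real of_real_mult[symmetric])
      moreover have "Re (of_real r * quadric_root (of_real (s t))
          + (\<Sum>q\<in>{..d}\<times>UNIV. \<alpha> q * tensor_mono d a q ?z)) = 0"
        using zero[of ?z] nz t unfolding s by simp
      ultimately have "r * (1 - sqrt (1 - s t) + (\<Sum>j\<le>d. x j * t ^ Suc j)) = 0"
        by (simp only: plus_complex.sel distrib_left)
      then have "poly p t = sqrt (1 - s t)"
        using r by (simp add: p_def poly_sum poly_monom)
      then show "poly (p\<^sup>2 - (1 - ps)) t = 0" using s1 by (simp add: ps)
    qed
    then have "poly (p\<^sup>2 - (1 - ps)) 2 = 0" by simp
    then have "(poly p 2)\<^sup>2 = 1 - s 2" by (simp add: ps)
    \<comment> \<open>The term of (0, a) alone is at least (1/2) * 4; this is why (0, a) must belong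
      to \<open>S\<close>.\<close>
    moreover have "s 2 \<ge> 2"
    proof -
      have "2 \<le> (tensor_coeff d a (0, a))\<^sup>2 * 2 ^ (2 * Suc 0)" by (simp add: tensor_coeff_power2)
      also have "\<dots> \<le> s 2"
        unfolding s_def using member_le_sum[OF S(2) _ fin, of
            "\<lambda>q. if snd q = a then (tensor_coeff d a q)\<^sup>2 * 2 ^ (2 * Suc (fst q)) else 0"] by auto
      finally show ?thesis .
    qed
    ultimately show False using zero_le_power2[of "poly p 2"] by linarith
  qed
  show "\<alpha> q = 0" if "q \<in> {..d} \<times> UNIV"
    by (rule tensor_mono_independent[OF e that]) (use zero r0 in simp)
qed

section \<open>The proper map into the type IV domain\<close>

text \<open>\<open>None\<close> carries the component h, \<open>Inl q\<close> the (possibly halved) component of index q, and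
  \<open>Inr q\<close> its second half, present only for q outside S.\<close>
definition slots :: "'q set \<Rightarrow> 'q set \<Rightarrow> ('q + 'q) option set" where
  "slots I S = insert None (Some ` (I <+> (I - S)))"

fun slot_value :: "'q set \<Rightarrow> ('q \<Rightarrow> complex) \<Rightarrow> complex \<Rightarrow> ('q + 'q) option \<Rightarrow> complex" where
  "slot_value S g h None = h"
| "slot_value S g h (Some (Inl q)) = (if q \<in> S then g q else of_real (1 / sqrt 2) * g q)"
| "slot_value S g h (Some (Inr q)) = \<i> * of_real (1 / sqrt 2) * g q"

lemma sum_slots:
  fixes \<Phi> :: "('q + 'q) option \<Rightarrow> 'b::comm_monoid_add"
  assumes "finite I" "S \<subseteq> I"
  shows "(\<Sum>x\<in>slots I S. \<Phi> x) = \<Phi> None +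
    ((\<Sum>q\<in>S. \<Phi> (Some (Inl q))) + (\<Sum>q\<in>I - S. \<Phi> (Some (Inl q)) + \<Phi> (Some (Inr q))))"
proof -
  have "(\<Sum>x\<in>slots I S. \<Phi> x) = \<Phi> None + (\<Sum>x\<in>Some ` (I <+> (I - S)). \<Phi> x)"
    unfolding slots_def using assms by (intro sum.insert) auto
  also have "(\<Sum>x\<in>Some ` (I <+> (I - S)). \<Phi> x) =
      (\<Sum>q\<in>I. \<Phi> (Some (Inl q))) + (\<Sum>q\<in>I - S. \<Phi> (Some (Inr q)))"
    using assms by (simp add: sum.reindex sum.Plus o_def)
  also have "(\<Sum>q\<in>I. \<Phi> (Some (Inl q))) = (\<Sum>q\<in>I - S. \<Phi> (Some (Inl q))) + (\<Sum>q\<in>S. \<Phi> (Some (Inl q)))"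
    using assms by (simp add: sum.subset_diff)
  finally show ?thesis by (simp add: sum.distrib add_ac)
qed

text \<open>The two halves of a split component have opposite squares and cancel.\<close>

lemma sum_slot_value_power2:
  assumes "finite I" "S \<subseteq> I"
  shows "(\<Sum>x\<in>slots I S. (slot_value S g h x)\<^sup>2) = h\<^sup>2 + (\<Sum>q\<in>S. (g q)\<^sup>2)"
proof -
  have "(of_real (1 / sqrt 2) * c)\<^sup>2 + (\<i> * of_real (1 / sqrt 2) * c)\<^sup>2 = 0" for c :: complex
    by (simp add: power_mult_distrib power_divide)
  then show ?thesis unfolding sum_slots[OF assms] by simp
qed

lemma sum_slot_value_norm:
  assumes "finite I" "S \<subseteq> I"
  shows "(\<Sum>x\<in>slots I S. (cmod (slot_value S g h x))\<^sup>2) = (cmod h)\<^sup>2 + (\<Sum>q\<in>I. (cmod (g q))\<^sup>2)"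
proof -
  have "(cmod (of_real (1 / sqrt 2) * c))\<^sup>2 + (cmod (\<i> * of_real (1 / sqrt 2) * c))\<^sup>2 = (cmod c)\<^sup>2"
    for c :: complex
    by (simp add: norm_mult norm_divide power_mult_distrib power_divide)
  moreover have "(\<Sum>q\<in>I. (cmod (g q))\<^sup>2) = (\<Sum>q\<in>I - S. (cmod (g q))\<^sup>2) + (\<Sum>q\<in>S. (cmod (g q))\<^sup>2)"
    using assms by (simp add: sum.subset_diff)
  ultimately show ?thesis unfolding sum_slots[OF assms] by (simp add: add_ac)
qed

text \<open>The two real coefficients of a split component merge into one complex coefficient, so
  real independence of the slots reduces to complex independence of the \<open>g q\<close> together
  with h.\<close>

lemma sum_slot_value_coeffs:
  assumes "finite I" "S \<subseteq> I"
  shows "(\<Sum>x\<in>slots I S. of_real (\<rho> x) * slot_value S g h x) = of_real (\<rho> None) * h +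
    (\<Sum>q\<in>I. (if q \<in> S then of_real (\<rho> (Some (Inl q)))
       else of_real (1 / sqrt 2) * Complex (\<rho> (Some (Inl q))) (\<rho> (Some (Inr q)))) * g q)"
    (is "_ = _ + (\<Sum>q\<in>I. ?c q * g q)")
proof -
  have "(\<Sum>q\<in>I. ?c q * g q) = (\<Sum>q\<in>S. ?c q * g q) + (\<Sum>q\<in>I - S. ?c q * g q)"
    using assms by (subst sum.subset_diff[of S I]) (simp_all add: add.commute)
  also have "(\<Sum>q\<in>S. ?c q * g q) = (\<Sum>q\<in>S. of_real (\<rho> (Some (Inl q))) * g q)"
    by (rule sum.cong) auto
  also have "(\<Sum>q\<in>I - S. ?c q * g q) = (\<Sum>q\<in>I - S. of_real (1 / sqrt 2) *
      Complex (\<rho> (Some (Inl q))) (\<rho> (Some (Inr q))) * g q)"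
    by (rule sum.cong) auto
  finally show ?thesis unfolding sum_slots[OF assms] by (simp add: Complex_eq algebra_simps)
qed

lemma card_slots:
  assumes "finite I" "S \<subseteq> I"
  shows "card (slots I S) + card S = 1 + 2 * card I"
proof -
  have "card (slots I S) = 1 + (card I + card (I - S))"
    unfolding slots_def using assms by (subst card_insert_disjoint) (auto simp: card_image card_Plus)
  moreover have "card (I - S) + card S = card I"
    using assms by (metis card_Diff_subset card_mono finite_subset le_add_diff_inverse2)
  ultimately show ?thesis by simp
qed

lemma mem_cball_unit_iff: "z \<in> cball_unit \<longleftrightarrow> norm z < 1"
  using power2_less_imp_less[of "norm z" 1] power_strict_mono[of "norm z" 1 2]
  by (auto simp: cball_unit_def norm_power2_vec[symmetric])

text \<open>The defining function has a positive minimum on a compact \<open>K\<close>, and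
  \<open>bound\<close> then keeps the preimage of \<open>K\<close> inside a closed ball of radius
  less than 1.\<close>

lemma proper_between_DIV:
  fixes F :: "complex^'n \<Rightarrow> complex^'m"
  assumes hol: "cholo cball_unit F" and maps: "F ` cball_unit \<subseteq> DIV" and C: "C > 0"
    and bound: "\<And>z. norm z < 1 \<Longrightarrow>
      1 - (norm (F z))\<^sup>2 + (1/4) * (cmod (\<Sum>i\<in>UNIV. (F z $ i)\<^sup>2))\<^sup>2 \<le> C * (1 - (norm z)\<^sup>2)"
  shows "proper_between cball_unit DIV F"
  unfolding proper_between_def
proof (intro conjI allI impI maps, elim conjE)
  fix K :: "(complex^'m) set" assume K: "K \<subseteq> DIV" "compact K"
  let ?\<rho> = "\<lambda>Z::complex^'m. 1 - (norm Z)\<^sup>2 + (1/4) * (cmod (\<Sum>i\<in>UNIV. (Z $ i)\<^sup>2))\<^sup>2"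
  show "compact (cball_unit \<inter> F -` K)"
  proof (cases "K = {}")
    case False
    have "continuous_on K ?\<rho>" by (intro continuous_intros)
    then obtain Z where Z: "Z \<in> K" "\<And>Y. Y \<in> K \<Longrightarrow> ?\<rho> Z \<le> ?\<rho> Y"
      using continuous_attains_inf[OF K(2) False] by blast
    define \<delta> where "\<delta> = ?\<rho> Z / C"
    have "?\<rho> Z > 0" using Z(1) K(1) unfolding DIV_def norm_power2_vec by blast
    then have \<delta>: "\<delta> > 0" using C by (simp add: \<delta>_def)
    define B where "B = {z::complex^'n. (norm z)\<^sup>2 \<le> 1 - \<delta>}"
    have B1: "norm z < 1" if "z \<in> B" for z
    proof -
      have "(norm z)\<^sup>2 < 1" using that \<delta> by (simp add: B_def)
      then show ?thesis by (simp add: power_less_one_iff abs_less_iff)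
    qed
    have "closed B" unfolding B_def by (intro closed_Collect_le continuous_intros)
    moreover have "bounded B" using B1 by (meson bounded_iff less_imp_le)
    ultimately have B: "compact B" by (simp add: compact_eq_bounded_closed)
    have "cball_unit \<inter> F -` K = B \<inter> F -` K"
    proof -
      have "z \<in> B" if "norm z < 1" "F z \<in> K" for z
      proof -
        have "?\<rho> Z \<le> C * (1 - (norm z)\<^sup>2)" using Z(2)[OF that(2)] bound[OF that(1)] by linarith
        then have "\<delta> \<le> 1 - (norm z)\<^sup>2" using C by (simp add: \<delta>_def pos_divide_le_eq mult.commute)
        then show ?thesis by (simp add: B_def)
      qed
      then show ?thesis using B1 by (auto simp: mem_cball_unit_iff)
    qed
    moreover have "continuous_on B F"
    proof (rule continuous_at_imp_continuous_on, rule ballI)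
      fix z assume "z \<in> B"
      then have "z \<in> cball_unit" using B1 by (simp add: mem_cball_unit_iff)
      then show "continuous (at z) F" using hol cholo_derivative has_derivative_continuous by metis
    qed
    then have "closed (B \<inter> F -` K)"
      using B K(2) by (intro continuous_closed_preimage) (auto simp: compact_imp_closed)
    then have "compact (B \<inter> (B \<inter> F -` K))" using B by (rule compact_Int_closed[rotated])
    ultimately show ?thesis by (simp add: Int_absorb1 inf.assoc[symmetric])
  qed simp
qed

theorem mainTheorem3:
  assumes "CARD('m::{finite,linorder}) \<ge> CARD('n::finite) + 1"
  shows "\<exists>F :: complex^('n::finite) \<Rightarrow> complex^('m::{finite,linorder}).
           cholo cball_unit F \<and> proper_between cball_unit DIV F \<and> minimum_map F"
proof -
  define n where "n = CARD('n)"
  define m where "m = CARD('m)"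
  have n: "n \<ge> 1" "m \<ge> n + 1" using assms by (simp_all add: n_def m_def Suc_le_eq)
  \<comment> \<open>The largest k with k n + 1 at most m; then m is also at most 2 k n. The monomial
    map will have \<open>d + 1\<close> = k levels of n components, so N = k n.\<close>
  define k where "k = (m - 1) div n"
  have k: "k \<ge> 1" using n by (simp add: k_def Suc_le_eq div_greater_zero_iff)
  have kn: "k * n + 1 \<le> m"
    unfolding k_def using n div_times_less_eq_dividend[of "m - 1" n] by linarith
  have "m - 1 < (k + 1) * n"
    unfolding k_def using n dividend_less_div_times[of n "m - 1"] by (simp add: algebra_simps)
  moreover have "(k + 1) * n \<le> 2 * (k * n)" using k by simp
  ultimately have m2: "m \<le> 2 * (k * n)" using n by linarith
  define d where "d = k - 1"
  \<comment> \<open>Any coordinate may carry the powers.\<close>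
  define a :: 'n where "a = undefined"
  define I :: "(nat \<times> 'n) set" where "I = {..d} \<times> UNIV"
  have fin: "finite I" by (simp add: I_def)
  have cardI: "card I = k * n" using k by (simp add: I_def card_cartesian_product d_def n_def)
  have aI: "(0, a) \<in> I" by (simp add: I_def)
  \<comment> \<open>Exactly m slots require 2 k n - m + 1 unsplit components. One of them is
    reserved for (0, a), as the independence lemma demands.\<close>
  have "2 * (k * n) - m \<le> card (I - {(0, a)})"
    using aI fin kn by (simp add: cardI)
  then obtain S' where S': "S' \<subseteq> I - {(0, a)}" "card S' = 2 * (k * n) - m" "finite S'"
    using obtain_subset_with_card_n by blast
  define S where "S = insert (0, a) S'"
  have S: "S \<subseteq> I" "(0, a) \<in> S" using S'(1) aI by (auto simp: S_def)
  have "card S = 2 * (k * n) - m + 1" using S' by (auto simp: S_def card_insert_if)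
  then have "card (slots I S) = CARD('m)"
    using card_slots[OF fin S(1)] m2 by (simp add: cardI m_def)
  moreover have "finite (slots I S)" by (simp add: slots_def fin)
  ultimately obtain \<beta> :: "'m \<Rightarrow> _" where \<beta>: "bij_betw \<beta> UNIV (slots I S)"
    using finite_same_card_bij[of "UNIV :: 'm set" "slots I S"] by auto
  define g where "g = tensor_mono d a"
  define s where "s z = (\<Sum>q\<in>S. (g q z)\<^sup>2)" for z
  define h where "h z = quadric_root (s z)" for z
  define F :: "complex^'n \<Rightarrow> complex^('m::{finite,linorder})"
    where "F z = (\<chi> i. slot_value S (\<lambda>q. g q z) (h z) (\<beta> i))" for z
  have F_nth: "F z $ i = slot_value S (\<lambda>q. g q z) (h z) (\<beta> i)" for z i by (simp add: F_def)
  have reindex: "(\<Sum>i\<in>UNIV. \<Phi> (\<beta> i)) = (\<Sum>x\<in>slots I S. \<Phi> x)" for \<Phi> :: "_ \<Rightarrow> 'b::comm_monoid_add"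
    by (rule sum.reindex_bij_betw[OF \<beta>])
  have F_sq: "(\<Sum>i\<in>UNIV. (F z $ i)\<^sup>2) = 2 * h z" for z
    unfolding F_nth reindex[of "\<lambda>x. (slot_value S (\<lambda>q. g q z) (h z) x)\<^sup>2"]
      sum_slot_value_power2[OF fin S(1)] s_def[symmetric]
    unfolding h_def by (rule quadric_root_eq)
  define T where "T z = (\<Sum>q\<in>I. (cmod (g q z))\<^sup>2)" for z
  have F_norm: "(norm (F z))\<^sup>2 = (cmod (h z))\<^sup>2 + T z" for z
    unfolding norm_power2_vec F_nth reindex[of "\<lambda>x. (cmod (slot_value S (\<lambda>q. g q z) (h z) x))\<^sup>2"]
      sum_slot_value_norm[OF fin S(1)] T_def ..
  have T1: "T z < 1" if "norm z < 1" for z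
    unfolding T_def g_def I_def using that by (rule sum_norm_tensor_mono_less)
  have s1: "cmod (s z) < 1" if "norm z < 1" for z
  proof -
    have "cmod (s z) \<le> (\<Sum>q\<in>S. (cmod (g q z))\<^sup>2)"
      unfolding s_def by (rule order_trans[OF norm_sum]) (simp add: norm_power)
    also have "\<dots> \<le> T z" unfolding T_def using S fin by (intro sum_mono2) auto
    finally show ?thesis using T1[OF that] by simp
  qed
  \<comment> \<open>The square sum 2 h contributes |h|^2, which cancels the same term in the norm of
    \<open>F z\<close>.\<close>
  have def_fun: "1 - (norm (F z))\<^sup>2 + (1/4) * (cmod (\<Sum>i\<in>UNIV. (F z $ i)\<^sup>2))\<^sup>2 = 1 - T z" for z
    unfolding F_sq F_norm by (simp add: norm_mult power_mult_distrib)
  have maps: "F ` cball_unit \<subseteq> DIV"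
  proof
    fix Z assume "Z \<in> F ` cball_unit"
    then obtain z where z: "norm z < 1" "Z = F z" by (auto simp: mem_cball_unit_iff)
    have "cmod (h z) < 1"
      using norm_quadric_root_le[of "s z"] s1[OF z(1)] by (simp add: h_def)
    then have "(cmod (h z))\<^sup>2 < 1" by (simp add: power_less_one_iff)
    then have "(norm (F z))\<^sup>2 < 2" using T1[OF z(1)] by (simp add: F_norm)
    then show "Z \<in> DIV"
      using T1[OF z(1)] unfolding DIV_def z(2) norm_power2_vec[symmetric] mem_Collect_eq def_fun by simp
  qed
  have g_hol: "scalar_cholo cball_unit (\<lambda>z. g q z)" for q
    unfolding g_def tensor_mono_def
    by (intro scalar_cholo_mult scalar_cholo_const scalar_cholo_power scalar_cholo_nth)
  have h_hol: "scalar_cholo cball_unit h"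
  proof -
    have "scalar_cholo cball_unit (\<lambda>z. 1 + (-1) * csqrt (1 + (-1) * s z))"
    proof (intro scalar_cholo_add scalar_cholo_mult scalar_cholo_csqrt scalar_cholo_const)
      show "scalar_cholo cball_unit s"
        unfolding s_def by (intro scalar_cholo_sum scalar_cholo_power g_hol)
      fix z :: "complex^'n" assume "z \<in> cball_unit"
      then have "Re (s z) < 1"
        using s1[of z] complex_Re_le_cmod[of "s z"] by (simp add: mem_cball_unit_iff)
      then show "1 + (-1) * s z \<notin> \<real>\<^sub>\<le>\<^sub>0" by (auto simp: complex_nonpos_Reals_iff)
    qed
    then show ?thesis by (simp add: h_def[abs_def] quadric_root_def)
  qed
  have hol: "cholo cball_unit F"
  proof (rule cholo_componentwise)
    fix i
    have "scalar_cholo cball_unit (\<lambda>z. slot_value S (\<lambda>q. g q z) (h z) x)" for x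
    proof (cases x)
      case None
      then show ?thesis using h_hol by simp
    next
      case (Some y)
      have c: "scalar_cholo cball_unit (\<lambda>z. c * g q z)" for c q
        by (intro scalar_cholo_mult scalar_cholo_const g_hol)
      show ?thesis
      proof (cases y)
        case (Inl q)
        show ?thesis unfolding Some Inl slot_value.simps
          using c g_hol by (cases "q \<in> S") (simp_all only: if_True if_False)
      next
        case (Inr q)
        show ?thesis unfolding Some Inr slot_value.simps by (rule c)
      qed
    qed
    then show "scalar_cholo cball_unit (\<lambda>z. F z $ i)" by (simp add: F_nth)
  qed
  have proper: "proper_between cball_unit DIV F"
  proof (rule proper_between_DIV[OF hol maps])
    \<comment> \<open>The constant bounds the geometric sum, whose d + 1 terms are each at most
      1.\<close>
    show "0 < real (d + 1)" by simp
    fix z :: "complex^'n" assume z: "norm z < 1"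
    have "((cmod (z $ a))\<^sup>2 / 2) ^ j \<le> 1" for j
    proof (rule power_le_one)
      have "cmod (z $ a) \<le> 1" using Finite_Cartesian_Product.norm_nth_le[of z a] z by simp
      then show "(cmod (z $ a))\<^sup>2 / 2 \<le> 1" using power_le_one[of "cmod (z $ a)" 2] by simp
    qed simp
    then have "(\<Sum>j\<le>d. ((cmod (z $ a))\<^sup>2 / 2) ^ j) \<le> real (d + 1)"
      using sum_mono[of "{..d}" "\<lambda>j. ((cmod (z $ a))\<^sup>2 / 2) ^ j" "\<lambda>_. 1"] by simp
    moreover have "1 - (norm z)\<^sup>2 \<ge> 0" using z by (simp add: power_le_one)
    ultimately have "(\<Sum>j\<le>d. ((cmod (z $ a))\<^sup>2 / 2) ^ j) * (1 - (norm z)\<^sup>2)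
        \<le> real (d + 1) * (1 - (norm z)\<^sup>2)"
      by (rule mult_right_mono)
    moreover have "1 - T z = (\<Sum>j\<le>d. ((cmod (z $ a))\<^sup>2 / 2) ^ j) * (1 - (norm z)\<^sup>2)"
      unfolding T_def g_def I_def sum_norm_tensor_mono by simp
    ultimately have "1 - T z \<le> real (d + 1) * (1 - (norm z)\<^sup>2)" by simp
    then show "1 - (norm (F z))\<^sup>2 + (1/4) * (cmod (\<Sum>i\<in>UNIV. (F z $ i)\<^sup>2))\<^sup>2
        \<le> real (d + 1) * (1 - (norm z)\<^sup>2)"
      unfolding def_fun .
  qed
  have "minimum_map F"
  proof (rule minimum_mapI[OF hol])
    have g0: "g q 0 = 0" for q by (simp add: g_def tensor_mono_def)
    then have "h 0 = 0" by (simp add: h_def s_def quadric_root_def)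
    then have "slot_value S (\<lambda>q. g q 0) (h 0) x = 0" for x
      by (cases "(S, \<lambda>q. g q 0, h 0, x)" rule: slot_value.cases) (auto simp: g0)
    then show "F 0 = 0" by (simp add: vec_eq_iff F_nth)
  next
    fix r :: "'m \<Rightarrow> real" and e :: real and i
    assume e: "e > 0" and zero: "\<And>z. norm z < e \<Longrightarrow> (\<Sum>i\<in>UNIV. of_real (r i) * F z $ i) = 0"
    \<comment> \<open>The coefficients are moved from coordinates to slots.\<close>
    define \<rho> where "\<rho> = r \<circ> inv \<beta>"
    have inj: "inj \<beta>" using \<beta> by (simp add: bij_betw_def)
    have r: "r i = \<rho> (\<beta> i)" for i by (simp add: \<rho>_def inj)
    define \<alpha> where "\<alpha> q = (if q \<in> S then of_real (\<rho> (Some (Inl q)))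
       else of_real (1 / sqrt 2) * Complex (\<rho> (Some (Inl q))) (\<rho> (Some (Inr q))))" for q
    have "of_real (\<rho> None) * quadric_root (\<Sum>q\<in>S. (tensor_mono d a q z)\<^sup>2)
        + (\<Sum>q\<in>{..d}\<times>UNIV. \<alpha> q * tensor_mono d a q z) = 0" if "norm z < e" for z
      using zero[OF that]
      unfolding F_nth r reindex[of "\<lambda>x. of_real (\<rho> x) * slot_value S (\<lambda>q. g q z) (h z) x"]
        sum_slot_value_coeffs[OF fin S(1)]
      unfolding \<alpha>_def h_def s_def g_def I_def .
    note indep = quadric_root_tensor_mono_independent[OF e S(1)[unfolded I_def] S(2) this]
    have \<alpha>0: "\<alpha> q = 0" if "q \<in> I" for q using indep(2) that by (simp add: I_def)
    have "\<rho> x = 0" if x: "x \<in> slots I S" for x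
    proof -
      consider "x = None" | q where "x = Some (Inl q)" "q \<in> I" | q where "x = Some (Inr q)" "q \<in> I - S"
        using x by (auto simp: slots_def)
      then show ?thesis
      proof cases
        case 1
        then show ?thesis using indep(1) by simp
      next
        case 2
        then show ?thesis using \<alpha>0[of q] by (auto simp: \<alpha>_def complex_eq_iff split: if_splits)
      next
        case 3
        then show ?thesis using \<alpha>0[of q] by (auto simp: \<alpha>_def complex_eq_iff split: if_splits)
      qed
    qed
    moreover have "\<beta> i \<in> slots I S" using \<beta> by (auto simp: bij_betw_def)
    ultimately show "r i = 0" by (simp add: r)
  next
    fix e :: real assume e: "e > 0"
    show "\<exists>z. norm z < e \<and> (\<Sum>i\<in>UNIV. (F z $ i)\<^sup>2) \<noteq> 0"
    proof (rule ccontr)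
      assume "\<not> ?thesis"
      then have "h z = 0" if "norm z < e" for z using that F_sq[of z] by auto
      \<comment> \<open>If h vanished near 0, the independence lemma with r = 1 and zero monomial
        coefficients would give 1 = 0.\<close>
      then have "of_real 1 * quadric_root (\<Sum>q\<in>S. (tensor_mono d a q z)\<^sup>2)
          + (\<Sum>q\<in>{..d}\<times>UNIV. 0 * tensor_mono d a q z) = 0" if "norm z < e" for z
        using that by (simp add: h_def s_def g_def)
      from quadric_root_tensor_mono_independent(1)[OF e S(1)[unfolded I_def] S(2) this]
      show False by simp
    qed
  qed
  then show ?thesis using hol proper by blast
qed

end
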